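(* Let $\alpha\in[0,1)$ be a fixed constant, and let $\varepsilon\in(0,1-\alpha)$, $\gamma\in(0,1-\alpha]$ and $K>0$ be arbitrary constants. There exists a constant $c>0$ (depending only on $\alpha,\varepsilon,\gamma,K$) such that, with probability $1-o(1)$ as $n\to\infty$ over the random graph $G\sim\mathcal{G}(n,\frac12,k=\lfloor n^\alpha\rfloor)$ with planted clique $\mathcal{PC}$, the following holds. For every $h:[n]\to\mathbb{R}$ with $h_0=0$ and $|h_q-h_{q'}|\le|q-q'|$ for all $q,q'\le2.1\log n$, every $m\in\mathbb{N}$ with $m\ge1$, all inverse temperatures $\beta_1<\beta_2<\dots<\beta_m$ with $\max_i|\beta_i|\le K\log n$, and all estimates $\widehat Z(\beta_i)>0$, $i=1,\dots,m$, there is an initial pair of clique and temperature such that the simulated tempering (ST) dynamics $\{(X_t,I_t)\}$ started from this pair requires, with probability at least $1-\exp(-c\log^2 n)$, at least $\exp(c\log^2 n)$ steps to reach a pair whose clique $X_t$ (i) either has size at least $(1+\varepsilon)\log n$, (ii) or has intersection at least $\gamma\log n$ with the planted clique.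
   Context: Conventions: $\log$ is the base-2 logarithm; $[n]=\{0,1,\dots,n\}$. Planted clique model: $\mathcal{G}(n,\frac12,k)$ is the random graph on an $n$-element vertex set $V$ obtained by sampling $\mathcal{G}(n,\frac12)$ (each pair is an edge independently with probability $1/2$), choosing a uniformly random $k$-subset $\mathcal{PC}\subseteq V$ (the planted clique), and adding all edges between vertices of $\mathcal{PC}$. $\Omega(G)$ denotes the set of all cliques of $G$, i.e. vertex subsets (including $\emptyset$) whose vertices are pairwise adjacent. ST dynamics: given $h:[n]\to\mathbb{R}$ (written $h_q=h(q)$), inverse temperatures $\beta_1<\dots<\beta_m$, positive numbers $\widehat Z(\beta_i)$ (thought of as estimates of the partition functions $Z(\beta_i)=\sum_{C\in\Omega(G)}\exp(\beta_i h_{|C|})$) and a parameter $a\in(0,1)$, this is the Markov chain $\{(X_t,I_t)\}$ on $\Omega(G)\times\{1,\dots,m\}$ with transition probabilities: (level move) for $C,C'\in\Omega(G)$ differing in exactly one vertex, $P((C,i),(C',i))=\frac{a}{n}\min\{1,\exp[\beta_i(h_{|C'|}-h_{|C|})]\}$; (temperature move) for $|i-i'|=1$, $P((C,i),(C,i'))=\frac{1-a}{2}\min\{1,\frac{\widehat Z(\beta_i)}{\widehat Z(\beta_{i'})}\exp[(\beta_{i'}-\beta_i)h_{|C|}]\}$; and the remaining probability is put on staying at the current state. *)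

theory Defs
  imports "HOL-Probability.Probability" "HOL-Probability.Product_PMF"
begin

section \<open>Graphs on \<open>{..<n}\<close> and the planted clique model\<close>

text \<open>A graph on the vertex set \<open>{..<n}\<close> is given by its edge set, a subset of \<open>vertex_pairs n\<close>.\<close>

definition vertex_pairs :: "nat \<Rightarrow> nat set set" where
  "vertex_pairs n = {e. e \<subseteq> {..<n} \<and> card e = 2}"

definition cliques :: "nat \<Rightarrow> nat set set \<Rightarrow> nat set set" where
  "cliques n E = {C. C \<subseteq> {..<n} \<and> (\<forall>u\<in>C. \<forall>v\<in>C. u \<noteq> v \<longrightarrow> {u, v} \<in> E)}"

definition gnp_half :: "nat \<Rightarrow> nat set set pmf" where
  "gnp_half n = map_pmf (\<lambda>f. {e \<in> vertex_pairs n. f e})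
     (Pi_pmf (vertex_pairs n) False (\<lambda>_. bernoulli_pmf (1/2)))"

text \<open>The joint law of the edge set and the planted clique, meaningful for \<open>k \<le> n\<close>.\<close>

definition planted_clique_pmf :: "nat \<Rightarrow> nat \<Rightarrow> (nat set set \<times> nat set) pmf" where
  "planted_clique_pmf n k =
     map_pmf (\<lambda>(E, PC). (E \<union> {e \<in> vertex_pairs n. e \<subseteq> PC}, PC))
       (pair_pmf (gnp_half n) (pmf_of_set {S. S \<subseteq> {..<n} \<and> card S = k}))"


section \<open>Trajectories of a Markov chain\<close>

text \<open>\<open>trajectory_pmf P T x\<close> is the law of \<open>[X\<^sub>0, \<dots>, X\<^sub>T]\<close> for the Markov chain with transition
  kernel \<open>P\<close> started from \<open>X\<^sub>0 = x\<close>.\<close>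

primrec trajectory_pmf :: "('s \<Rightarrow> 's pmf) \<Rightarrow> nat \<Rightarrow> 's \<Rightarrow> 's list pmf" where
  "trajectory_pmf P 0 x = return_pmf [x]"
| "trajectory_pmf P (Suc T) x =
     bind_pmf (P x) (\<lambda>y. map_pmf (\<lambda>xs. x # xs) (trajectory_pmf P T y))"

text \<open>The probability that the chain started from \<open>x\<close> requires at least \<open>r\<close> steps to reach \<open>B\<close>,
  i.e. that \<open>X\<^sub>t \<notin> B\<close> for all times \<open>t < r\<close>. This event only depends on
  \<open>X\<^sub>0, \<dots>, X\<^sub>T\<close> for any \<open>T \<ge> r\<close>; the choice \<open>T = \<lceil>r\<rceil>\<close> is used.\<close>

definition prob_requires_steps :: "('s \<Rightarrow> 's pmf) \<Rightarrow> 's \<Rightarrow> 's set \<Rightarrow> real \<Rightarrow> real" where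
  "prob_requires_steps P x B r =
     measure_pmf.prob (trajectory_pmf P (nat \<lceil>r\<rceil>) x)
       {xs. \<forall>t::nat. real t < r \<longrightarrow> xs ! t \<notin> B}"


section \<open>Simulated tempering\<close>

text \<open>The estimate for the \<open>i\<close>-th partition function is \<open>Z i\<close>; only the values of \<open>\<beta>\<close> and
  \<open>Z\<close> on \<open>{1..m}\<close> and of \<open>h\<close> on \<open>{0..n}\<close> matter.\<close>

definition st_states :: "nat \<Rightarrow> nat set set \<Rightarrow> nat \<Rightarrow> (nat set \<times> nat) set" where
  "st_states n E m = cliques n E \<times> {1..m}"

definition st_move ::
  "nat \<Rightarrow> (nat \<Rightarrow> real) \<Rightarrow> (nat \<Rightarrow> real) \<Rightarrow> (nat \<Rightarrow> real) \<Rightarrow> real \<Rightarrow>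
   nat set \<times> nat \<Rightarrow> nat set \<times> nat \<Rightarrow> real" where
  "st_move n h \<beta> Z a = (\<lambda>(C, i) (C', i').
     if i = i' \<and> card ((C - C') \<union> (C' - C)) = 1 then
       a / real n * min 1 (exp (\<beta> i * (h (card C') - h (card C))))
     else if C = C' \<and> (i' = i + 1 \<or> i = i' + 1) then
       (1 - a) / 2 * min 1 (Z i / Z i' * exp ((\<beta> i' - \<beta> i) * h (card C)))
     else 0)"

definition st_prob ::
  "nat \<Rightarrow> nat set set \<Rightarrow> nat \<Rightarrow> (nat \<Rightarrow> real) \<Rightarrow> (nat \<Rightarrow> real) \<Rightarrow> (nat \<Rightarrow> real) \<Rightarrow> real \<Rightarrow>
   nat set \<times> nat \<Rightarrow> nat set \<times> nat \<Rightarrow> real" where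
  "st_prob n E m h \<beta> Z a x y =
     (if y = x then 1 - (\<Sum>z\<in>st_states n E m - {x}. st_move n h \<beta> Z a x z)
      else if y \<in> st_states n E m then st_move n h \<beta> Z a x y
      else 0)"

text \<open>The use of \<open>embed_pmf\<close> is justified by \<open>pmf_st_kernel\<close> below.\<close>

definition st_kernel ::
  "nat \<Rightarrow> nat set set \<Rightarrow> nat \<Rightarrow> (nat \<Rightarrow> real) \<Rightarrow> (nat \<Rightarrow> real) \<Rightarrow> (nat \<Rightarrow> real) \<Rightarrow> real \<Rightarrow>
   nat set \<times> nat \<Rightarrow> (nat set \<times> nat) pmf" where
  "st_kernel n E m h \<beta> Z a x = embed_pmf (st_prob n E m h \<beta> Z a x)"

lemma finite_st_states: "finite (st_states n E m)"
proof -
  have "cliques n E \<subseteq> Pow {..<n}"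
    by (auto simp: cliques_def)
  then have "finite (cliques n E)"
    by (rule finite_subset) simp
  then show ?thesis
    by (simp add: st_states_def)
qed

lemma st_move_nonneg:
  assumes "0 < a" "a < 1" "\<forall>i\<in>{1..m}. 0 < Z i"
    and "x \<in> st_states n E m" "y \<in> st_states n E m"
  shows "0 \<le> st_move n h \<beta> Z a x y"
proof -
  obtain C i C' i' where xy: "x = (C, i)" "y = (C', i')"
    by (metis surj_pair)
  have "0 < Z i" "0 < Z i'"
    using assms xy by (auto simp: st_states_def)
  then show ?thesis
    using assms(1,2) by (auto simp: st_move_def xy intro!: mult_nonneg_nonneg)
qed

lemma st_move_sum_le_1:
  assumes a: "0 < a" "a < 1" and Z: "\<forall>i\<in>{1..m}. 0 < Z i"
    and x: "x \<in> st_states n E m"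
  shows "(\<Sum>z\<in>st_states n E m - {x}. st_move n h \<beta> Z a x z) \<le> 1"
proof -
  obtain C i where xe: "x = (C, i)"
    by (metis surj_pair)
  define S where "S = st_states n E m - {x}"
  define L where "L = {z \<in> S. snd z = i \<and> card ((C - fst z) \<union> (fst z - C)) = 1}"
  define T where "T = {z \<in> S. fst z = C \<and> (snd z = i + 1 \<or> i = snd z + 1)}"
  have fS: "finite S"
    by (simp add: S_def finite_st_states)
  have fin: "finite L" "finite T"
    using fS by (auto simp: L_def T_def)
  have disj: "L \<inter> T = {}"
    by (auto simp: L_def T_def)
  have Ln: "card L \<le> n"
  proof -
    have "L \<subseteq> (\<lambda>v. ((C - {v}) \<union> ({v} - C), i)) ` {..<n}"
    proof
      fix z assume z: "z \<in> L"
      obtain C' where ze: "z = (C', i)"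
        using z by (cases z) (auto simp: L_def)
      from z ze obtain v where v: "(C - C') \<union> (C' - C) = {v}"
        by (auto simp: L_def card_1_singleton_iff)
      have "C \<subseteq> {..<n}" "C' \<subseteq> {..<n}"
        using x z unfolding xe ze L_def S_def by (auto simp: st_states_def cliques_def)
      then have "v < n"
        using v by blast
      moreover have "C' = (C - {v}) \<union> ({v} - C)"
        using v by blast
      ultimately show "z \<in> (\<lambda>v. ((C - {v}) \<union> ({v} - C), i)) ` {..<n}"
        using ze by blast
    qed
    then have "card L \<le> card {..<n}"
      by (rule surj_card_le[rotated]) simp
    then show ?thesis by simp
  qed
  have T2: "card T \<le> 2"
  proof -
    have "T \<subseteq> {(C, i + 1), (C, i - 1)}"
      by (auto simp: T_def)
    then have "card T \<le> card {(C, i + 1), (C, i - 1)}"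
      by (intro card_mono) auto
    also have "\<dots> \<le> 2"
      by (simp add: card_insert_if)
    finally show ?thesis .
  qed
  have "sum (st_move n h \<beta> Z a x) S = sum (st_move n h \<beta> Z a x) (L \<union> T)"
    by (intro sum.mono_neutral_right fS) (auto simp: L_def T_def st_move_def xe split: if_splits)
  also have "\<dots> = sum (st_move n h \<beta> Z a x) L + sum (st_move n h \<beta> Z a x) T"
    by (rule sum.union_disjoint[OF fin disj])
  also have "\<dots> \<le> real (card L) * (a / n) + real (card T) * ((1 - a) / 2)"
  proof (intro add_mono sum_bounded_above)
    fix z assume z: "z \<in> L"
    have "st_move n h \<beta> Z a x z =
        a / n * min 1 (exp (\<beta> i * (h (card (fst z)) - h (card C))))"
      using z by (cases z) (auto simp: L_def st_move_def xe)
    also have "\<dots> \<le> a / n * 1"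
      using a by (intro mult_left_mono) auto
    finally show "st_move n h \<beta> Z a x z \<le> a / n" by simp
  next
    fix z assume z: "z \<in> T"
    have "st_move n h \<beta> Z a x z =
        (1 - a) / 2 * min 1 (Z i / Z (snd z) * exp ((\<beta> (snd z) - \<beta> i) * h (card C)))"
      using z by (cases z) (auto simp: T_def st_move_def xe)
    also have "\<dots> \<le> (1 - a) / 2 * 1"
      using a by (intro mult_left_mono) auto
    finally show "st_move n h \<beta> Z a x z \<le> (1 - a) / 2" by simp
  qed
  also have "\<dots> \<le> a + (1 - a)"
  proof (rule add_mono)
    have "real (card L) * (a / n) \<le> real n * (a / n)"
      using Ln a by (intro mult_right_mono) auto
    also have "\<dots> \<le> a"
      using a by simp
    finally show "real (card L) * (a / n) \<le> a" .
    have "real (card T) * ((1 - a) / 2) \<le> 2 * ((1 - a) / 2)"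
      using T2 a by (intro mult_right_mono) auto
    then show "real (card T) * ((1 - a) / 2) \<le> 1 - a" by simp
  qed
  finally show ?thesis
    by (simp add: S_def)
qed

lemma pmf_st_kernel:
  assumes a: "0 < a" "a < 1" and Z: "\<forall>i\<in>{1..m}. 0 < Z i"
    and x: "x \<in> st_states n E m"
  shows "pmf (st_kernel n E m h \<beta> Z a x) y = st_prob n E m h \<beta> Z a x y"
proof -
  let ?S = "st_states n E m"
  let ?p = "st_prob n E m h \<beta> Z a x"
  have nn: "0 \<le> ?p y" for y
    using st_move_sum_le_1[OF a Z x] st_move_nonneg[OF a Z x]
    by (auto simp: st_prob_def)
  have "sum ?p ?S = ?p x + sum ?p (?S - {x})"
    by (rule sum.remove[OF finite_st_states x])
  also have "sum ?p (?S - {x}) = (\<Sum>z\<in>?S - {x}. st_move n h \<beta> Z a x z)"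
    by (intro sum.cong) (auto simp: st_prob_def)
  finally have s1: "sum ?p ?S = 1"
    by (simp add: st_prob_def)
  have "(\<integral>\<^sup>+ y. ennreal (?p y) \<partial>count_space UNIV) = (\<Sum>y\<in>?S. ennreal (?p y))"
    using x finite_st_states[of n E m]
    by (intro nn_integral_count_space') (auto simp: st_prob_def)
  also have "\<dots> = 1"
    using nn s1 by (simp add: sum_ennreal)
  finally show ?thesis
    unfolding st_kernel_def using nn by (intro pmf_embed_pmf) auto
qed

end

theory Submission
  imports Defs "HOL-Real_Asymp.Real_Asymp"
begin

text \<open>Write \<open>L = log 2 n\<close>. The measure giving \<open>(C, i)\<close> weight \<open>exp (\<beta> i * h (card C)) / Z i\<close> is
  reversible, so for a barrier \<open>B\<close> that must be crossed when leaving a set \<open>A\<close>, some start in \<open>A\<close>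
  hits \<open>B\<close> within \<open>T\<close> steps with probability at most about \<open>T\<close> times the weight ratio of \<open>B\<close> to \<open>A\<close>.
  Both sets are unions of full temperature columns, so it suffices to bound this ratio at each
  temperature separately and the estimates \<open>Z\<close> play no role.

  Here \<open>A\<close> consists of the cliques of size at most \<open>q \<approx> (1 + 2\<delta>)L\<close> with fewer than \<open>s \<approx> \<gamma>L\<close> planted
  vertices. The barrier consists of the cliques with exactly \<open>s\<close> planted vertices, and of Jerrum's
  gateways: cliques of size \<open>q\<close> from which a larger clique can be reached by acquiring \<open>r \<approx> \<delta>L\<close> new
  vertices, each adjacent to at least \<open>q - r \<ge> (1 + \<delta>)L\<close> old ones. On each level of sizes the weight is
  constant, so there only cardinalities matter. First moments bound the barrier, a second moment bounds
  the number of cliques avoiding the planted one from below. Levels between \<open>q\<close> and \<open>q + r\<close> are compared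
  with level \<open>q\<close> by the Lipschitz condition, at a cost \<open>exp (K\<delta>L\<^sup>2)\<close> that is negligible for small \<open>\<delta>\<close>.\<close>

section \<open>Hitting times of reversible chains\<close>

lemma set_pmf_trajectory:
  assumes "xs \<in> set_pmf (trajectory_pmf P T x)"
  shows "length xs = Suc T \<and> xs ! 0 = x \<and> (\<forall>t<T. xs ! Suc t \<in> set_pmf (P (xs ! t)))"
  using assms
proof (induction T arbitrary: x xs)
  case 0
  then show ?case by simp
next
  case (Suc T)
  then obtain y ys where y: "y \<in> set_pmf (P x)" "ys \<in> set_pmf (trajectory_pmf P T y)" "xs = x # ys"
    by auto
  with Suc.IH[OF y(2)] show ?case
    by (auto simp: nth_Cons split: nat.splits)
qed

lemma measure_bind_pmf:
  "measure_pmf.prob (bind_pmf M f) A = measure_pmf.expectation M (\<lambda>y. measure_pmf.prob (f y) A)"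
  unfolding measure_pmf_bind
  by (rule measure_pmf.measure_bind[where N = "count_space UNIV"])
    (auto simp: measure_pmf_in_subprob_algebra)

lemma trajectory_hit_Suc:
  fixes P :: "'s \<Rightarrow> 's pmf"
  assumes "finite S" "set_pmf (P x) \<subseteq> S"
  shows "measure_pmf.prob (trajectory_pmf P (Suc T) x) {xs. \<exists>y\<in>set xs. y \<in> B}
    \<le> indicator B x + (\<Sum>y\<in>S. pmf (P x) y * measure_pmf.prob (trajectory_pmf P T y) {xs. \<exists>y\<in>set xs. y \<in> B})"
proof (cases "x \<in> B")
  case True
  then show ?thesis
    by (intro order.trans[OF measure_pmf.prob_le_1]) (auto intro!: sum_nonneg)
next
  case False
  have "measure_pmf.prob (trajectory_pmf P (Suc T) x) {xs. \<exists>y\<in>set xs. y \<in> B}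
      = measure_pmf.expectation (P x) (\<lambda>y. measure_pmf.prob (trajectory_pmf P T y) {xs. \<exists>y\<in>set xs. y \<in> B})"
    using False by (simp add: measure_bind_pmf vimage_def)
  also have "\<dots> = (\<Sum>y\<in>S. measure_pmf.prob (trajectory_pmf P T y) {xs. \<exists>y\<in>set xs. y \<in> B} * pmf (P x) y)"
    using assms by (intro integral_measure_pmf_real) auto
  finally show ?thesis
    using False by (simp add: mult.commute)
qed

text \<open>This is the union bound over the \<open>T + 1\<close> times for the chain started from
  the unnormalised measure \<open>\<nu>\<close>: sub-invariance keeps the mass inside
  \<open>B\<close> at every time at most \<open>sum \<nu> (S \<inter> B)\<close>. In the induction
  the indicator of the start contributes one such mass, and swapping the two sums reduces the rest
  to one step less.\<close>

lemma trajectory_hit_bound: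
  fixes P :: "'s \<Rightarrow> 's pmf" and \<nu> :: "'s \<Rightarrow> real"
  assumes S: "finite S" "\<And>x. x \<in> S \<Longrightarrow> set_pmf (P x) \<subseteq> S"
    and nn: "\<And>x. x \<in> S \<Longrightarrow> 0 \<le> \<nu> x"
    and inv: "\<And>y. y \<in> S \<Longrightarrow> (\<Sum>x\<in>S. \<nu> x * pmf (P x) y) \<le> \<nu> y"
  shows "(\<Sum>x\<in>S. \<nu> x * measure_pmf.prob (trajectory_pmf P T x) {xs. \<exists>y\<in>set xs. y \<in> B})
    \<le> real (Suc T) * sum \<nu> (S \<inter> B)"
proof (induction T)
  case 0
  have "(\<Sum>x\<in>S. \<nu> x * measure_pmf.prob (trajectory_pmf P 0 x) {xs. \<exists>y\<in>set xs. y \<in> B})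
      = (\<Sum>x\<in>S. \<nu> x * indicator B x)"
    by (intro sum.cong) (auto simp: indicator_def)
  also have "\<dots> = sum \<nu> (S \<inter> B)"
    using S by (simp add: sum.inter_restrict indicator_def if_distrib cong: if_cong)
  finally show ?case by simp
next
  case (Suc T)
  let ?H = "\<lambda>T x. measure_pmf.prob (trajectory_pmf P T x) {xs. \<exists>y\<in>set xs. y \<in> B}"
  have "(\<Sum>x\<in>S. \<nu> x * ?H (Suc T) x)
      \<le> (\<Sum>x\<in>S. \<nu> x * (indicator B x + (\<Sum>y\<in>S. pmf (P x) y * ?H T y)))"
    using S nn by (intro sum_mono mult_left_mono trajectory_hit_Suc) auto
  also have "\<dots> = (\<Sum>x\<in>S. \<nu> x * indicator B x) + (\<Sum>x\<in>S. \<Sum>y\<in>S. (\<nu> x * pmf (P x) y) * ?H T y)"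
    by (simp add: distrib_left sum.distrib sum_distrib_left mult_ac)
  also have "(\<Sum>x\<in>S. \<Sum>y\<in>S. (\<nu> x * pmf (P x) y) * ?H T y)
      = (\<Sum>y\<in>S. (\<Sum>x\<in>S. \<nu> x * pmf (P x) y) * ?H T y)"
    by (subst sum.swap) (simp add: sum_distrib_right)
  also have "\<dots> \<le> (\<Sum>y\<in>S. \<nu> y * ?H T y)"
    by (intro sum_mono mult_right_mono inv) auto
  also have "\<dots> \<le> real (Suc T) * sum \<nu> (S \<inter> B)"
    by (rule Suc.IH)
  also have "(\<Sum>x\<in>S. \<nu> x * indicator B x) = sum \<nu> (S \<inter> B)"
    using S by (simp add: sum.inter_restrict indicator_def if_distrib cong: if_cong)
  finally show ?case
    by (simp add: algebra_simps)
qed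

text \<open>Averaging: if every start in \<open>A\<close> hit \<open>B\<close> more often than
  claimed, the \<open>\<nu>\<close>-weighted sum of hitting probabilities over \<open>A\<close>
  alone would exceed the bound for all of \<open>S\<close>.\<close>

lemma exists_start_rarely_hitting:
  fixes P :: "'s \<Rightarrow> 's pmf" and \<nu> :: "'s \<Rightarrow> real"
  assumes S: "finite S" "\<And>x. x \<in> S \<Longrightarrow> set_pmf (P x) \<subseteq> S"
    and nn: "\<And>x. x \<in> S \<Longrightarrow> 0 \<le> \<nu> x"
    and inv: "\<And>y. y \<in> S \<Longrightarrow> (\<Sum>x\<in>S. \<nu> x * pmf (P x) y) \<le> \<nu> y"
    and A: "A \<subseteq> S" "0 < sum \<nu> A"
    and B: "sum \<nu> (S \<inter> B) \<le> \<kappa> * sum \<nu> A"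
  shows "\<exists>x\<in>A. measure_pmf.prob (trajectory_pmf P T x) {xs. \<exists>y\<in>set xs. y \<in> B} \<le> real (Suc T) * \<kappa>"
proof (rule ccontr)
  let ?H = "\<lambda>x. measure_pmf.prob (trajectory_pmf P T x) {xs. \<exists>y\<in>set xs. y \<in> B}"
  assume "\<not> ?thesis"
  then have gt: "real (Suc T) * \<kappa> < ?H x" if "x \<in> A" for x
    using that by fastforce
  have fA: "finite A"
    using A S finite_subset by blast
  have nnA: "0 \<le> \<nu> x" if "x \<in> A" for x
    using that A nn by blast
  \<comment> \<open>A point of positive weight makes the comparison of the weighted sums
    strict.\<close>
  obtain z where z: "z \<in> A" "0 < \<nu> z"
    using A(2) nnA by (metis less_eq_real_def not_less sum_nonpos)
  have "(\<Sum>x\<in>A. \<nu> x * (real (Suc T) * \<kappa>)) < (\<Sum>x\<in>A. \<nu> x * ?H x)"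
    using gt nnA z
    by (intro sum_strict_mono_ex1 fA ballI bexI[of _ z] mult_left_mono mult_strict_left_mono)
      (auto intro: less_imp_le)
  also have "\<dots> \<le> (\<Sum>x\<in>S. \<nu> x * ?H x)"
    using A S nn by (intro sum_mono2) auto
  also have "\<dots> \<le> real (Suc T) * sum \<nu> (S \<inter> B)"
    by (rule trajectory_hit_bound[OF S nn inv])
  also have "\<dots> \<le> real (Suc T) * (\<kappa> * sum \<nu> A)"
    by (intro mult_left_mono B) simp
  finally show False
    by (simp add: sum_distrib_right mult_ac flip: sum_distrib_left)
qed

section \<open>Simulated tempering\<close>

text \<open>The unnormalised stationary measure of the chain; dividing by \<open>Z i\<close> matches
  the ratio \<open>Z i / Z i'\<close> in the acceptance probability of temperature moves.\<close>

definition st_weight :: "(nat \<Rightarrow> real) \<Rightarrow> (nat \<Rightarrow> real) \<Rightarrow> (nat \<Rightarrow> real) \<Rightarrow> nat set \<times> nat \<Rightarrow> real" where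
  "st_weight h \<beta> Z = (\<lambda>(C, i). exp (\<beta> i * h (card C)) / Z i)"

text \<open>The Metropolis identity: its right-hand side is symmetric in \<open>u\<close> and
  \<open>v\<close>, which is the source of detailed balance.\<close>

lemma mult_min_ratio:
  fixes c u v :: real
  assumes "0 < u"
  shows "u * (c * min 1 (v / u)) = c * min u v"
proof -
  have "u * min 1 (v / u) = min u v"
    using assms by (auto simp: min_def field_simps)
  then show ?thesis
    by (metis mult.left_commute)
qed

text \<open>Detailed balance. Both kinds of move propose symmetrically and accept with
  \<open>min 1 (v / u)\<close>, where \<open>u\<close> and \<open>v\<close> are the weights of the
  old and the new state, so the flow in either direction is the same constant times
  \<open>min u v\<close>.\<close>

lemma st_weight_move_commute:
  assumes Z: "0 < Z (snd x)" "0 < Z (snd y)"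
  shows "st_weight h \<beta> Z x * st_move n h \<beta> Z a x y = st_weight h \<beta> Z y * st_move n h \<beta> Z a y x"
proof -
  obtain C i C' i' where xy: "x = (C, i)" "y = (C', i')"
    by (metis surj_pair)
  let ?u = "exp (\<beta> i * h (card C)) / Z i" and ?v = "exp (\<beta> i' * h (card C')) / Z i'"
  have pos: "0 < ?u" "0 < ?v"
    using Z xy by auto
  have sd: "(C - C') \<union> (C' - C) = (C' - C) \<union> (C - C')"
    by blast
  show ?thesis
  proof (cases "i = i' \<and> card ((C - C') \<union> (C' - C)) = 1")
    case True
    \<comment> \<open>A level move keeps the temperature, so the estimates cancel in the weight
      ratio.\<close>
    have e: "exp (\<beta> i * (h (card C') - h (card C))) = ?v / ?u"
      "exp (\<beta> i' * (h (card C) - h (card C'))) = ?u / ?v"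
      using Z xy True by (simp_all add: right_diff_distrib exp_diff)
    have "?u * (a / n * min 1 (?v / ?u)) = a / n * min ?u ?v"
      by (rule mult_min_ratio[OF pos(1)])
    moreover have "?v * (a / n * min 1 (?u / ?v)) = a / n * min ?v ?u"
      by (rule mult_min_ratio[OF pos(2)])
    moreover have True': "i' = i \<and> card ((C' - C) \<union> (C - C')) = 1"
      using True sd by metis
    moreover have "st_move n h \<beta> Z a x y = a / n * min 1 (?v / ?u)"
      unfolding st_move_def xy prod.case if_P[OF True] e ..
    moreover have "st_move n h \<beta> Z a y x = a / n * min 1 (?u / ?v)"
      unfolding st_move_def xy prod.case if_P[OF True'] e ..
    ultimately show ?thesis
      unfolding st_weight_def xy prod.case by (metis min.commute)
  next
    case not_level: False
    have not_level': "\<not> (i' = i \<and> card ((C' - C) \<union> (C - C')) = 1)"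
      using not_level sd by auto
    show ?thesis
    proof (cases "C = C' \<and> (i' = i + 1 \<or> i = i' + 1)")
      case True
      have e: "Z i / Z i' * exp ((\<beta> i' - \<beta> i) * h (card C)) = ?v / ?u"
        "Z i' / Z i * exp ((\<beta> i - \<beta> i') * h (card C')) = ?u / ?v"
        using Z xy True by (simp_all add: left_diff_distrib exp_diff)
      have "?u * ((1 - a) / 2 * min 1 (?v / ?u)) = (1 - a) / 2 * min ?u ?v"
        by (rule mult_min_ratio[OF pos(1)])
      moreover have "?v * ((1 - a) / 2 * min 1 (?u / ?v)) = (1 - a) / 2 * min ?v ?u"
        by (rule mult_min_ratio[OF pos(2)])
      moreover have True': "C' = C \<and> (i = i' + 1 \<or> i' = i + 1)"
        using True by metis
      moreover have "st_move n h \<beta> Z a x y = (1 - a) / 2 * min 1 (?v / ?u)"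
        unfolding st_move_def xy prod.case if_not_P[OF not_level] if_P[OF True] e ..
      moreover have "st_move n h \<beta> Z a y x = (1 - a) / 2 * min 1 (?u / ?v)"
        unfolding st_move_def xy prod.case if_not_P[OF not_level'] if_P[OF True'] e ..
      ultimately show ?thesis
        unfolding st_weight_def xy prod.case by (metis min.commute)
    next
      case False
      then have "\<not> (C' = C \<and> (i = i' + 1 \<or> i' = i + 1))"
        by auto
      then show ?thesis
        unfolding st_move_def xy prod.case if_not_P[OF not_level] if_not_P[OF not_level'] if_not_P[OF False]
        by (simp only: if_not_P mult_zero_right if_False)
    qed
  qed
qed

lemma set_pmf_st_kernel:
  assumes "0 < a" "a < 1" "\<forall>i\<in>{1..m}. 0 < Z i" "x \<in> st_states n E m"
  shows "set_pmf (st_kernel n E m h \<beta> Z a x) \<subseteq> st_states n E m"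
  using assms by (auto simp: set_pmf_eq pmf_st_kernel st_prob_def split: if_splits)

lemma st_kernel_move:
  assumes "0 < a" "a < 1" "\<forall>i\<in>{1..m}. 0 < Z i" "x \<in> st_states n E m"
    and "y \<in> set_pmf (st_kernel n E m h \<beta> Z a x)"
  shows "fst y = fst x \<or> card ((fst x - fst y) \<union> (fst y - fst x)) = 1"
  using assms by (auto simp: set_pmf_eq pmf_st_kernel st_prob_def st_move_def split: if_splits prod.splits)

lemma st_weight_invariant:
  assumes a: "0 < a" "a < 1" and Z: "\<forall>i\<in>{1..m}. 0 < Z i" and y: "y \<in> st_states n E m"
  shows "(\<Sum>x\<in>st_states n E m. st_weight h \<beta> Z x * pmf (st_kernel n E m h \<beta> Z a x) y) = st_weight h \<beta> Z y"
proof -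
  let ?S = "st_states n E m" and ?K = "st_kernel n E m h \<beta> Z a"
  have "st_weight h \<beta> Z x * pmf (?K x) y = st_weight h \<beta> Z y * pmf (?K y) x" if x: "x \<in> ?S" for x
  proof (cases "x = y")
    case False
    have "snd x \<in> {1..m}" "snd y \<in> {1..m}"
      using x y by (auto simp: st_states_def)
    then have "st_weight h \<beta> Z x * st_move n h \<beta> Z a x y = st_weight h \<beta> Z y * st_move n h \<beta> Z a y x"
      using Z by (intro st_weight_move_commute) auto
    then show ?thesis
      using False x y by (simp add: pmf_st_kernel[OF a Z] st_prob_def)
  qed auto
  then have "(\<Sum>x\<in>?S. st_weight h \<beta> Z x * pmf (?K x) y) = (\<Sum>x\<in>?S. st_weight h \<beta> Z y * pmf (?K y) x)"
    by (rule sum.cong[OF refl])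
  also have "\<dots> = st_weight h \<beta> Z y * (\<Sum>x\<in>?S. pmf (?K y) x)"
    by (simp add: sum_distrib_left)
  also have "(\<Sum>x\<in>?S. pmf (?K y) x) = 1"
    using set_pmf_st_kernel[OF a Z y] by (intro sum_pmf_eq_1 finite_st_states)
  finally show ?thesis by simp
qed

section \<open>The barrier\<close>

text \<open>The clique \<open>C'\<close> records the moment at which exactly \<open>r\<close>
  vertices outside \<open>C\<close> have been collected; \<open>q \<le> card C'\<close> forces at
  least \<open>q - r\<close> vertices of \<open>C\<close> to be still present. The many edges this
  requires make gateways rare.\<close>

definition gateways :: "nat \<Rightarrow> nat set set \<Rightarrow> nat set \<Rightarrow> nat \<Rightarrow> nat \<Rightarrow> nat \<Rightarrow> nat set set" where
  "gateways n E PC q r s = {C \<in> cliques n E. card C = q \<and> card (C \<inter> PC) < s \<and>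
     (\<exists>C'\<in>cliques n E. q \<le> card C' \<and> card (C' - C) = r)}"

text \<open>The cap \<open>q + r\<close> limits the sizes to be controlled. It loses nothing,
  because a confined clique has fewer than \<open>q + r\<close> vertices and a move adds at most
  one.\<close>

definition barrier :: "nat \<Rightarrow> nat set set \<Rightarrow> nat set \<Rightarrow> nat \<Rightarrow> nat \<Rightarrow> nat \<Rightarrow> nat set set" where
  "barrier n E PC q r s =
     gateways n E PC q r s \<union> {C \<in> cliques n E. card C \<le> q + r \<and> card (C \<inter> PC) = s}"

definition small_cliques :: "nat \<Rightarrow> nat set set \<Rightarrow> nat set \<Rightarrow> nat \<Rightarrow> nat \<Rightarrow> nat set set" where
  "small_cliques n E PC q s = {C \<in> cliques n E. card C \<le> q \<and> card (C \<inter> PC) < s}"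

lemma finite_cliques: "finite (cliques n E)"
proof -
  have "cliques n E \<subseteq> Pow {..<n}"
    by (auto simp: cliques_def)
  then show ?thesis
    by (rule finite_subset) simp
qed

lemma finite_clique: "C \<in> cliques n E \<Longrightarrow> finite C"
  by (auto simp: cliques_def intro: finite_subset)

text \<open>Above level \<open>q\<close> a trajectory is tied to the clique \<open>D\<close> at its last visit to level \<open>q\<close>:
  as long as \<open>D\<close> is no gateway, fewer than \<open>r\<close> vertices outside \<open>D\<close> can be acquired.\<close>

definition confined :: "nat \<Rightarrow> nat set set \<Rightarrow> nat set \<Rightarrow> nat \<Rightarrow> nat \<Rightarrow> nat \<Rightarrow> nat set \<Rightarrow> bool" where
  "confined n E PC q r s C \<longleftrightarrow> C \<in> cliques n E \<and> card (C \<inter> PC) < s \<and>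
     (q \<le> card C \<longrightarrow> (\<exists>D\<in>cliques n E. card D = q \<and> card (D \<inter> PC) < s \<and>
        D \<notin> gateways n E PC q r s \<and> card (C - D) < r))"

lemma confined_card_less:
  assumes "confined n E PC q r s C" "0 < r"
  shows "card C < q + r"
proof (cases "q \<le> card C")
  case True
  then obtain D where D: "D \<in> cliques n E" "card D = q" "card (C - D) < r"
    using assms by (auto simp: confined_def)
  have "finite C" "finite D"
    using assms D finite_clique by (auto simp: confined_def)
  then have "card C \<le> card (D \<union> (C - D))"
    by (intro card_mono) auto
  also have "\<dots> \<le> card D + card (C - D)"
    by (rule card_Un_le)
  finally show ?thesis
    using D by simp
qed (use assms in simp)

text \<open>At size exactly \<open>q\<close> the clique is its own anchor \<open>D\<close>, since
  \<open>C - C\<close> is empty; below \<open>q\<close> there is no condition on an anchor.\<close>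

lemma confined_start:
  assumes "C \<in> small_cliques n E PC q s" "C \<notin> barrier n E PC q r s" "0 < r"
  shows "confined n E PC q r s C"
  using assms unfolding confined_def small_cliques_def barrier_def by (auto intro!: bexI[of _ C])

lemma card_sym_diff_singleton_le:
  assumes "finite C" "finite C'" "card ((C - C') \<union> (C' - C)) = 1"
  shows "card C' \<le> card C + 1" "card C \<le> card C' + 1" "card (C' \<inter> A) \<le> card (C \<inter> A) + 1"
    "card (C' - A) \<le> card (C - A) + 1"
proof -
  obtain v where v: "(C - C') \<union> (C' - C) = {v}"
    using assms(3) by (auto simp: card_1_singleton_iff)
  have sub: "C' \<subseteq> insert v C" "C \<subseteq> insert v C'"
    using v by blast+
  have le: "card X \<le> card Y + 1" if "X \<subseteq> insert v Y" "finite Y" for X Y :: "'a set"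
  proof -
    have "card X \<le> card (insert v Y)"
      using that by (intro card_mono) auto
    then show ?thesis
      using that by (simp add: card_insert_if split: if_splits)
  qed
  show "card C' \<le> card C + 1" "card C \<le> card C' + 1" "card (C' \<inter> A) \<le> card (C \<inter> A) + 1"
    "card (C' - A) \<le> card (C - A) + 1"
    using sub assms(1,2) by (blast intro!: le finite_Int finite_Diff)+
qed

text \<open>A move changes every count by at most one, so a strict bound can fail only through
  equality. Equality \<open>card (C' \<inter> PC) = s\<close> puts \<open>C'\<close> on the barrier,
  and equality \<open>card (C' - D) = r\<close> above level \<open>q\<close> exhibits
  \<open>D\<close> as a gateway.\<close>

lemma confined_step:
  assumes C: "confined n E PC q r s C" and r: "0 < r"
    and C': "C' \<in> cliques n E" "C' \<notin> barrier n E PC q r s"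
    and step: "C' = C \<or> card ((C - C') \<union> (C' - C)) = 1"
  shows "confined n E PC q r s C'"
proof (cases "C' = C")
  case False
  then have sd: "card ((C - C') \<union> (C' - C)) = 1"
    using step by blast
  have fin: "finite C" "finite C'"
    using C C' finite_clique by (auto simp: confined_def)
  note cards = card_sym_diff_singleton_le[OF fin sd]
  have "card C' \<le> q + r"
    using cards(1) confined_card_less[OF C r] by simp
  then have "card (C' \<inter> PC) \<noteq> s"
    using C' by (auto simp: barrier_def)
  moreover have "card (C' \<inter> PC) \<le> s"
    using cards(3)[of PC] C by (auto simp: confined_def)
  ultimately have overlap: "card (C' \<inter> PC) < s"
    by simp
  show ?thesis
  proof (cases "card C' \<le> q")
    case True
    \<comment> \<open>At or below level \<open>q\<close> the old anchor is dropped; at level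
      \<open>q\<close> the clique \<open>C'\<close> becomes the new one.\<close>
    then show ?thesis
      using overlap C' r by (intro confined_start) (auto simp: small_cliques_def)
  next
    case False
    then have "q \<le> card C"
      using cards(1) by simp
    then obtain D where D: "D \<in> cliques n E" "card D = q" "card (D \<inter> PC) < s"
        "D \<notin> gateways n E PC q r s" "card (C - D) < r"
      using C by (auto simp: confined_def)
    have "card (C' - D) \<noteq> r"
      using D C' False by (auto simp: gateways_def)
    then have "card (C' - D) < r"
      using cards(4)[of D] D by simp
    then show ?thesis
      using overlap C' D by (auto simp: confined_def)
  qed
qed (use C in simp)

lemma trajectory_confined:
  assumes par: "0 < a" "a < 1" "\<forall>i\<in>{1..m}. 0 < Z i" and r: "0 < r"
    and x: "x \<in> small_cliques n E PC q s \<times> {1..m}"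
    and xs: "xs \<in> set_pmf (trajectory_pmf (st_kernel n E m h \<beta> Z a) T x)"
    and avoid: "\<forall>y\<in>set xs. fst y \<notin> barrier n E PC q r s"
    and t: "t \<le> T"
  shows "xs ! t \<in> st_states n E m \<and> confined n E PC q r s (fst (xs ! t))"
  using t
proof (induction t)
  case 0
  have "xs ! 0 = x" "xs ! 0 \<in> set xs"
    using set_pmf_trajectory[OF xs] by (auto intro!: nth_mem)
  moreover have "confined n E PC q r s (fst x)" if "fst x \<notin> barrier n E PC q r s"
    using that x r by (intro confined_start) auto
  ultimately show ?case
    using x avoid by (auto simp: st_states_def small_cliques_def)
next
  case (Suc t)
  let ?x = "xs ! t" and ?y = "xs ! Suc t"
  have IH: "?x \<in> st_states n E m" "confined n E PC q r s (fst ?x)"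
    using Suc by auto
  have y: "?y \<in> set_pmf (st_kernel n E m h \<beta> Z a ?x)" "?y \<in> set xs"
    using set_pmf_trajectory[OF xs] Suc.prems by (auto intro!: nth_mem)
  then have "?y \<in> st_states n E m"
    using set_pmf_st_kernel[OF par IH(1)] by blast
  moreover have "fst ?y = fst ?x \<or> card ((fst ?x - fst ?y) \<union> (fst ?y - fst ?x)) = 1"
    using st_kernel_move[OF par IH(1) y(1)] .
  ultimately show ?case
    using avoid y IH r by (auto simp: st_states_def intro!: confined_step[OF IH(2)])
qed

text \<open>Until the barrier is hit, a trajectory from \<open>small_cliques\<close> stays confined
  and hence off the target \<open>B\<close>. The chance of meeting the barrier is bounded by the
  hitting estimate with \<open>T = nat \<lceil>R\<rceil>\<close>; the factor
  \<open>nat \<lceil>R\<rceil> + 1\<close> counts the times from 0 to \<open>T\<close>.\<close>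

lemma st_slow:
  assumes par: "0 < a" "a < 1" "\<forall>i\<in>{1..m}. 0 < Z i" and m: "1 \<le> m" and pos: "0 < r" "0 < s"
    and bottleneck: "\<And>i. i \<in> {1..m} \<Longrightarrow>
      (\<Sum>C\<in>barrier n E PC q r s. exp (\<beta> i * h (card C)))
        \<le> \<kappa> * (\<Sum>C\<in>small_cliques n E PC q s. exp (\<beta> i * h (card C)))"
    and target: "\<And>C i. (C, i) \<in> B \<Longrightarrow> q + r \<le> card C \<or> s \<le> card (C \<inter> PC)"
  shows "\<exists>x\<in>st_states n E m.
    1 - real (nat \<lceil>R\<rceil> + 1) * \<kappa> \<le> prob_requires_steps (st_kernel n E m h \<beta> Z a) x B R"
proof -
  let ?S = "st_states n E m" and ?P = "st_kernel n E m h \<beta> Z a" and ?\<nu> = "st_weight h \<beta> Z"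
  let ?A = "small_cliques n E PC q s \<times> {1..m}"
  let ?H = "\<lambda>D. {C. fst C \<in> D} :: (nat set \<times> nat) set"
  let ?D = "barrier n E PC q r s"
  have AS: "?A \<subseteq> ?S"
    by (auto simp: small_cliques_def st_states_def)
  have fin: "finite (small_cliques n E PC q s)" "finite ?D"
    using finite_cliques by (auto simp: small_cliques_def barrier_def gateways_def)
  have nn: "0 < ?\<nu> x" if "x \<in> ?S" for x
    using that par by (cases x) (auto simp: st_weight_def st_states_def)
  have sum_eq: "sum ?\<nu> (X \<times> {1..m}) = (\<Sum>i\<in>{1..m}. (\<Sum>C\<in>X. exp (\<beta> i * h (card C))) / Z i)"
    for X
    by (simp add: st_weight_def sum.cartesian_product[symmetric] sum.swap[of _ _ X] sum_divide_distrib)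
  have "?S \<inter> ?H ?D = ?D \<times> {1..m}"
    by (auto simp: st_states_def barrier_def gateways_def)
  then have "sum ?\<nu> (?S \<inter> ?H ?D) = (\<Sum>i\<in>{1..m}. (\<Sum>C\<in>?D. exp (\<beta> i * h (card C))) / Z i)"
    by (simp only: sum_eq)
  \<comment> \<open>The inequality at temperature \<open>i\<close> is divided by
    \<open>Z i > 0\<close> before summing, so the same \<open>\<kappa>\<close> survives for any
    estimates.\<close>
  also have "\<dots> \<le> (\<Sum>i\<in>{1..m}. \<kappa> * (\<Sum>C\<in>small_cliques n E PC q s. exp (\<beta> i * h (card C))) / Z i)"
    using par by (intro sum_mono divide_right_mono bottleneck) (auto intro: less_imp_le)
  also have "\<dots> = \<kappa> * sum ?\<nu> ?A"
    by (simp only: sum_eq sum_distrib_left times_divide_eq_right)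
  finally have bn: "sum ?\<nu> (?S \<inter> ?H ?D) \<le> \<kappa> * sum ?\<nu> ?A" .
  \<comment> \<open>The empty clique guarantees a starting set of positive weight.\<close>
  have "({}, 1) \<in> ?A"
    using pos m by (auto simp: small_cliques_def cliques_def)
  then have "0 < sum ?\<nu> ?A"
    using AS nn fin by (intro sum_pos) (auto simp del: mem_Sigma_iff)
  then obtain x where x: "x \<in> ?A" and
    hit: "measure_pmf.prob (trajectory_pmf ?P (nat \<lceil>R\<rceil>) x) {xs. \<exists>y\<in>set xs. y \<in> ?H ?D}
      \<le> real (Suc (nat \<lceil>R\<rceil>)) * \<kappa>"
    using exists_start_rarely_hitting[where S = ?S and P = ?P and \<nu> = ?\<nu> and A = ?A and B = "?H ?D"
        and \<kappa> = \<kappa> and T = "nat \<lceil>R\<rceil>", OF finite_st_states set_pmf_st_kernel[OF par] less_imp_le[OF nn] _ AS _ bn]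
      st_weight_invariant[OF par, of _ n E h \<beta>]
    by auto
  let ?traj = "trajectory_pmf ?P (nat \<lceil>R\<rceil>) x"
  have "1 - measure_pmf.prob ?traj {xs. \<exists>y\<in>set xs. y \<in> ?H ?D}
      = measure_pmf.prob ?traj (UNIV - {xs. \<exists>y\<in>set xs. y \<in> ?H ?D})"
    by (subst measure_pmf.prob_compl[symmetric]) auto
  also have "\<dots> \<le> measure_pmf.prob ?traj {xs. \<forall>t::nat. real t < R \<longrightarrow> xs ! t \<notin> B}"
  proof (rule measure_pmf.finite_measure_mono_AE)
    show "AE xs in ?traj. xs \<in> UNIV - {xs. \<exists>y\<in>set xs. y \<in> ?H ?D} \<longrightarrow>
        xs \<in> {xs. \<forall>t::nat. real t < R \<longrightarrow> xs ! t \<notin> B}"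
      unfolding AE_measure_pmf_iff
    proof (intro ballI impI CollectI allI)
      fix xs t
      assume xs: "xs \<in> set_pmf ?traj" "xs \<in> UNIV - {xs. \<exists>y\<in>set xs. y \<in> ?H ?D}" and t: "real t < R"
      have "t \<le> nat \<lceil>R\<rceil>"
        using t by linarith
      then have "confined n E PC q r s (fst (xs ! t))"
        using trajectory_confined[OF par pos(1) x xs(1)] xs(2) by auto
      then have "card (fst (xs ! t)) < q + r" "card (fst (xs ! t) \<inter> PC) < s"
        using confined_card_less pos by (auto simp: confined_def)
      then show "xs ! t \<notin> B"
        using target[of "fst (xs ! t)" "snd (xs ! t)"] by auto
    qed
  qed auto
  finally have "1 - real (Suc (nat \<lceil>R\<rceil>)) * \<kappa> \<le> prob_requires_steps ?P x B R"
    using hit unfolding prob_requires_steps_def by linarith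
  then show ?thesis
    using x AS by (intro bexI[of _ x]) auto
qed

section \<open>Moments of clique counts\<close>

definition pairs :: "'a set \<Rightarrow> 'a set set" where
  "pairs A = {e. e \<subseteq> A \<and> card e = 2}"

lemma finite_pairs: "finite A \<Longrightarrow> finite (pairs A)"
  by (simp add: pairs_def)

lemma card_pairs: "finite A \<Longrightarrow> card (pairs A) = card A choose 2"
  by (simp add: pairs_def n_subsets)

lemma pairs_Int: "pairs (A \<inter> B) = pairs A \<inter> pairs B"
  by (auto simp: pairs_def)

lemma pairs_mono: "A \<subseteq> B \<Longrightarrow> pairs A \<subseteq> pairs B"
  by (auto simp: pairs_def)

lemma vertex_pairs_eq: "vertex_pairs n = pairs {..<n}"
  by (simp add: vertex_pairs_def pairs_def)

lemma card_pairs_Diff: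
  assumes "finite A"
  shows "card (pairs A - pairs B) = (card A choose 2) - (card (A \<inter> B) choose 2)"
proof -
  have "card (pairs A - pairs (A \<inter> B)) = card (pairs A) - card (pairs (A \<inter> B))"
    using assms by (intro card_Diff_subset finite_pairs pairs_mono) auto
  moreover have "pairs A - pairs (A \<inter> B) = pairs A - pairs B"
    by (auto simp: pairs_Int)
  ultimately show ?thesis
    using assms by (simp add: card_pairs)
qed

text \<open>Planting makes the pairs inside \<open>PC\<close> free, so only the other pairs of
  \<open>C\<close> constrain the random edges. Every count below thereby becomes a count of fixed
  edge sets contained in \<open>E\<close>.\<close>

lemma cliques_planted_iff:
  "C \<in> cliques n (E \<union> {e \<in> vertex_pairs n. e \<subseteq> PC}) \<longleftrightarrow> C \<subseteq> {..<n} \<and> pairs C - pairs PC \<subseteq> E"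
proof -
  let ?G = "E \<union> {e \<in> vertex_pairs n. e \<subseteq> PC}"
  have "pairs C - pairs PC \<subseteq> E"
    if C: "\<forall>u\<in>C. \<forall>v\<in>C. u \<noteq> v \<longrightarrow> {u, v} \<in> ?G"
  proof
    fix e assume e: "e \<in> pairs C - pairs PC"
    then obtain u v where "e = {u, v}" "u \<noteq> v" "u \<in> C" "v \<in> C"
      by (auto simp: pairs_def card_2_iff)
    then show "e \<in> E"
      using C e by (auto simp: pairs_def)
  qed
  moreover have "{u, v} \<in> ?G"
    if "pairs C - pairs PC \<subseteq> E" "u \<in> C" "v \<in> C" "u \<noteq> v" "C \<subseteq> {..<n}" for u v
  proof -
    have "{u, v} \<in> pairs C"
      using that by (auto simp: pairs_def)
    with that(1) have "{u, v} \<in> E \<or> {u, v} \<in> pairs PC"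
      by blast
    moreover have "{u, v} \<in> vertex_pairs n"
      using that by (auto simp: vertex_pairs_def)
    ultimately show ?thesis
      by (auto simp: pairs_def)
  qed
  ultimately show ?thesis
    by (auto simp: cliques_def)
qed

section \<open>First and second moments in the uniform random graph\<close>

lemma finite_set_pmf_gnp_half: "finite (set_pmf (gnp_half n))"
proof -
  have "set_pmf (gnp_half n) \<subseteq> Pow (vertex_pairs n)"
    by (auto simp: gnp_half_def)
  then show ?thesis
    by (rule finite_subset) (simp add: vertex_pairs_eq finite_pairs)
qed

lemma integrable_gnp_half [simp, intro]:
  fixes f :: "nat set set \<Rightarrow> real"
  shows "integrable (measure_pmf (gnp_half n)) f"
  by (rule integrable_measure_pmf_finite[OF finite_set_pmf_gnp_half])

lemma prob_gnp_half_superset: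
  assumes "F \<subseteq> vertex_pairs n"
  shows "measure_pmf.prob (gnp_half n) {E. F \<subseteq> E} = (1/2) ^ card F"
proof -
  have fin: "finite (vertex_pairs n)"
    by (simp add: vertex_pairs_eq finite_pairs)
  have "(\<lambda>f. {e \<in> vertex_pairs n. f e}) -` {E. F \<subseteq> E}
      = Pi (vertex_pairs n) (\<lambda>e. if e \<in> F then {True} else UNIV)"
    using assms by (auto simp: Pi_def)
  then have "measure_pmf.prob (gnp_half n) {E. F \<subseteq> E}
      = (\<Prod>e\<in>vertex_pairs n. measure_pmf.prob (bernoulli_pmf (1/2)) (if e \<in> F then {True} else UNIV))"
    by (simp add: gnp_half_def measure_Pi_pmf_Pi[OF fin])
  also have "\<dots> = (\<Prod>e\<in>vertex_pairs n. if e \<in> F then 1/2 else 1)"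
    by (intro prod.cong) (auto simp: measure_pmf_single)
  also have "\<dots> = (\<Prod>e\<in>vertex_pairs n \<inter> F. 1/2)"
    using fin by (subst prod.inter_restrict) auto
  also have "vertex_pairs n \<inter> F = F"
    using assms by blast
  finally show ?thesis
    by simp
qed

lemma card_filter_eq_sum_indicator:
  assumes "finite X"
  shows "real (card {x \<in> X. P x}) = (\<Sum>x\<in>X. of_bool (P x))"
proof -
  have "{x \<in> X. P x} = X \<inter> Collect P"
    by auto
  then show ?thesis
    using assms by (simp add: sum_of_bool_eq)
qed

lemma expectation_superset:
  assumes "F \<subseteq> vertex_pairs n"
  shows "measure_pmf.expectation (gnp_half n) (\<lambda>E. of_bool (F \<subseteq> E)) = (1/2 :: real) ^ card F"
proof -
  have "(\<lambda>E. of_bool (F \<subseteq> E) :: real) = indicator {E. F \<subseteq> E}"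
    by (auto simp: indicator_def)
  then show ?thesis
    by (simp add: prob_gnp_half_superset[OF assms])
qed

lemma expectation_count:
  assumes "finite X" "\<And>x. x \<in> X \<Longrightarrow> F x \<subseteq> vertex_pairs n"
  shows "measure_pmf.expectation (gnp_half n) (\<lambda>E. real (card {x \<in> X. F x \<subseteq> E}))
    = (\<Sum>x\<in>X. (1/2) ^ card (F x))"
proof -
  have "measure_pmf.expectation (gnp_half n) (\<lambda>E. real (card {x \<in> X. F x \<subseteq> E}))
      = measure_pmf.expectation (gnp_half n) (\<lambda>E. \<Sum>x\<in>X. of_bool (F x \<subseteq> E))"
    by (simp only: card_filter_eq_sum_indicator[OF assms(1)])
  also have "\<dots> = (\<Sum>x\<in>X. measure_pmf.expectation (gnp_half n) (\<lambda>E. of_bool (F x \<subseteq> E)))"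
    by (rule Bochner_Integration.integral_sum) auto
  finally show ?thesis
    using assms by (simp add: expectation_superset)
qed

lemma expectation_count_squared:
  assumes "finite X" "\<And>x. x \<in> X \<Longrightarrow> F x \<subseteq> vertex_pairs n"
  shows "measure_pmf.expectation (gnp_half n) (\<lambda>E. (real (card {x \<in> X. F x \<subseteq> E}))\<^sup>2)
    = (\<Sum>x\<in>X. \<Sum>y\<in>X. (1/2) ^ card (F x \<union> F y))"
proof -
  have "(real (card {x \<in> X. F x \<subseteq> E}))\<^sup>2 = (\<Sum>x\<in>X. \<Sum>y\<in>X. of_bool (F x \<union> F y \<subseteq> E))" for E
    unfolding card_filter_eq_sum_indicator[OF assms(1)] power2_eq_square sum_product
    by (intro sum.cong refl) auto
  then have "measure_pmf.expectation (gnp_half n) (\<lambda>E. (real (card {x \<in> X. F x \<subseteq> E}))\<^sup>2)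
      = (\<Sum>x\<in>X. \<Sum>y\<in>X. measure_pmf.expectation (gnp_half n) (\<lambda>E. of_bool (F x \<union> F y \<subseteq> E)))"
    by (simp add: Bochner_Integration.integral_sum del: Un_subset_iff sup.bounded_iff)
  also have "\<dots> = (\<Sum>x\<in>X. \<Sum>y\<in>X. (1/2) ^ card (F x \<union> F y))"
    using assms by (intro sum.cong refl expectation_superset) auto
  finally show ?thesis .
qed

lemma prob_gnp_half_Markov:
  assumes "0 < t" "\<And>E. 0 \<le> f E"
  shows "measure_pmf.prob (gnp_half n) {E. t \<le> f E} \<le> measure_pmf.expectation (gnp_half n) f / t"
  using integral_Markov_inequality_measure[of "measure_pmf (gnp_half n)" f UNIV t] assms by simp

lemma first_moment:
  assumes "finite X" "\<And>x. x \<in> X \<Longrightarrow> F x \<subseteq> vertex_pairs n" "0 < t"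
    and "(\<Sum>x\<in>X. (1/2) ^ card (F x)) \<le> M"
  shows "measure_pmf.prob (gnp_half n) {E. t \<le> real (card {x \<in> X. F x \<subseteq> E})} \<le> M / t"
proof -
  have "measure_pmf.prob (gnp_half n) {E. t \<le> real (card {x \<in> X. F x \<subseteq> E})}
      \<le> measure_pmf.expectation (gnp_half n) (\<lambda>E. real (card {x \<in> X. F x \<subseteq> E})) / t"
    by (rule prob_gnp_half_Markov) (use assms in auto)
  also have "\<dots> \<le> M / t"
    using assms by (simp add: expectation_count divide_right_mono)
  finally show ?thesis .
qed

text \<open>Chebyshev at distance \<open>\<mu> / 2\<close>: the last hypothesis bounds the variance
  by \<open>\<eta> * \<mu>\<^sup>2\<close>, and dividing by \<open>(\<mu> / 2)\<^sup>2\<close>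
  produces the factor 4.\<close>

lemma second_moment:
  assumes X: "finite X" "\<And>x. x \<in> X \<Longrightarrow> F x \<subseteq> vertex_pairs n"
    and \<mu>: "\<mu> = (\<Sum>x\<in>X. (1/2) ^ card (F x))" "0 < \<mu>"
    and sq: "(\<Sum>x\<in>X. \<Sum>y\<in>X. (1/2) ^ card (F x \<union> F y)) \<le> (1 + \<eta>) * \<mu>\<^sup>2"
  shows "measure_pmf.prob (gnp_half n) {E. real (card {x \<in> X. F x \<subseteq> E}) < \<mu> / 2} \<le> 4 * \<eta>"
proof -
  let ?c = "\<lambda>E. real (card {x \<in> X. F x \<subseteq> E})" and ?E = "measure_pmf.expectation (gnp_half n)"
  have "{E. ?c E < \<mu> / 2} \<subseteq> {E. (\<mu> / 2)\<^sup>2 \<le> (?c E - \<mu>)\<^sup>2}"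
  proof (intro Collect_mono impI)
    fix E assume "?c E < \<mu> / 2"
    then have "(\<mu> / 2)\<^sup>2 \<le> (\<mu> - ?c E)\<^sup>2"
      using \<mu> by (intro power_mono) auto
    then show "(\<mu> / 2)\<^sup>2 \<le> (?c E - \<mu>)\<^sup>2"
      by (simp only: power2_commute)
  qed
  then have "measure_pmf.prob (gnp_half n) {E. ?c E < \<mu> / 2}
      \<le> measure_pmf.prob (gnp_half n) {E. (\<mu> / 2)\<^sup>2 \<le> (?c E - \<mu>)\<^sup>2}"
    by (intro measure_pmf.finite_measure_mono) auto
  also have "\<dots> \<le> ?E (\<lambda>E. (?c E - \<mu>)\<^sup>2) / (\<mu> / 2)\<^sup>2"
    using \<mu> by (intro prob_gnp_half_Markov) auto
  also have "?E (\<lambda>E. (?c E - \<mu>)\<^sup>2) = ?E (\<lambda>E. (?c E)\<^sup>2 - (2 * \<mu>) * ?c E + \<mu>\<^sup>2)"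
    by (simp add: power2_diff algebra_simps)
  also have "\<dots> = ?E (\<lambda>E. (?c E)\<^sup>2) - (2 * \<mu>) * ?E ?c + \<mu>\<^sup>2"
    by simp
  also have "\<dots> = (\<Sum>x\<in>X. \<Sum>y\<in>X. (1/2) ^ card (F x \<union> F y)) - \<mu>\<^sup>2"
    using X by (simp only: expectation_count_squared[OF X] expectation_count[OF X] \<mu>(1)[symmetric])
      (simp add: power2_eq_square)
  also have "\<dots> / (\<mu> / 2)\<^sup>2 \<le> (\<eta> * \<mu>\<^sup>2) / (\<mu> / 2)\<^sup>2"
    using sq by (intro divide_right_mono) (auto simp: algebra_simps)
  also have "\<dots> = 4 * \<eta>"
    using \<mu>(2) by (simp add: power2_eq_square)
  finally show ?thesis .
qed

section \<open>Counting subsets by their overlap with a fixed set\<close>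

lemma card_subsets_overlap:
  assumes V: "finite V" and j: "j \<le> l"
  shows "card {C. C \<subseteq> V \<and> card C = l \<and> card (C \<inter> U) = j}
    = (card (V \<inter> U) choose j) * (card (V - U) choose (l - j))"
proof -
  let ?A = "{A. A \<subseteq> V \<inter> U \<and> card A = j}" and ?B = "{B. B \<subseteq> V - U \<and> card B = l - j}"
  have "bij_betw (\<lambda>C. (C \<inter> U, C - U)) {C. C \<subseteq> V \<and> card C = l \<and> card (C \<inter> U) = j} (?A \<times> ?B)"
  proof (rule bij_betw_byWitness[where f' = "\<lambda>(A, B). A \<union> B"])
    show "(\<lambda>C. (C \<inter> U, C - U)) ` {C. C \<subseteq> V \<and> card C = l \<and> card (C \<inter> U) = j} \<subseteq> ?A \<times> ?B"
      using V by (auto simp: card_Diff_subset_Int finite_subset)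
    have "card (A \<union> B) = l" "(A \<union> B) \<inter> U = A"
      if "A \<subseteq> V \<inter> U" "card A = j" "B \<subseteq> V - U" "card B = l - j" for A B
    proof -
      have "finite A" "finite B"
        using that V by (auto intro: finite_subset)
      then show "card (A \<union> B) = l"
        using that j by (subst card_Un_disjoint) auto
    qed (use that in auto)
    then show "(\<lambda>(A, B). A \<union> B) ` (?A \<times> ?B) \<subseteq> {C. C \<subseteq> V \<and> card C = l \<and> card (C \<inter> U) = j}"
      by auto
  qed auto
  then have "card {C. C \<subseteq> V \<and> card C = l \<and> card (C \<inter> U) = j} = card (?A \<times> ?B)"
    by (rule bij_betw_same_card)
  then show ?thesis
    using V by (simp only: card_cartesian_product n_subsets finite_Int finite_Diff disjI1)
qed

lemma sum_subsets_overlap: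
  fixes f :: "nat \<Rightarrow> real"
  assumes V: "finite V"
  shows "(\<Sum>C | C \<subseteq> V \<and> card C = l. f (card (C \<inter> U)))
    = (\<Sum>j\<le>l. real (card (V \<inter> U) choose j) * real (card (V - U) choose (l - j)) * f j)"
proof -
  let ?X = "{C. C \<subseteq> V \<and> card C = l}"
  have "(\<Sum>C\<in>?X. f (card (C \<inter> U))) = (\<Sum>j\<le>l. \<Sum>C\<in>{C \<in> ?X. card (C \<inter> U) = j}. f (card (C \<inter> U)))"
  proof (intro sum.group[symmetric])
    show "(\<lambda>C. card (C \<inter> U)) ` ?X \<subseteq> {..l}"
      using V by (auto intro: card_mono dest: finite_subset)
  qed (use V in auto)
  also have "\<dots> = (\<Sum>j\<le>l. real (card (V \<inter> U) choose j) * real (card (V - U) choose (l - j)) * f j)"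
  proof (intro sum.cong refl)
    fix j assume "j \<in> {..l}"
    then have "card {C \<in> ?X. card (C \<inter> U) = j} = (card (V \<inter> U) choose j) * (card (V - U) choose (l - j))"
      using card_subsets_overlap[OF V, of j l U] by (simp add: conj_assoc)
    then show "(\<Sum>C\<in>{C \<in> ?X. card (C \<inter> U) = j}. f (card (C \<inter> U)))
        = real (card (V \<inter> U) choose j) * real (card (V - U) choose (l - j)) * f j"
      by simp
  qed
  finally show ?thesis .
qed

text \<open>Lowering the lower index of the binomial coefficient by one costs a factor of at most
  \<open>l / M\<close>, by \<open>(N choose i) * (N - i) = Suc i * (N choose Suc i)\<close>.\<close>

lemma choose_diff_le:
  fixes M :: real
  assumes "j \<le> l" "l \<le> N" "0 \<le> M" "M \<le> real (N - l + 1)"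
  shows "real (N choose (l - j)) * M ^ j \<le> real (N choose l) * real l ^ j"
  using assms(1)
proof (induction j)
  case (Suc j)
  define i where "i = l - Suc j"
  have i: "l - j = Suc i" "i < N" "Suc i \<le> l"
    using Suc.prems assms by (auto simp: i_def)
  have "real (N choose i) * M \<le> real (N choose i) * real (N - i)"
    using assms i by (intro mult_left_mono) auto
  also have "\<dots> = real (Suc i) * real (N choose Suc i)"
    by (metis binomial_absorb_comp binomial_absorption mult.commute of_nat_mult)
  also have "\<dots> \<le> real l * real (N choose Suc i)"
    using i by (intro mult_right_mono) auto
  finally have "real (N choose i) * M * M ^ j \<le> real l * real (N choose Suc i) * M ^ j"
    using assms by (intro mult_right_mono) auto
  also have "\<dots> \<le> real l * (real (N choose l) * real l ^ j)"
    using Suc i by (simp add: mult.assoc mult_left_mono)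
  finally show ?case
    by (simp add: i_def mult_ac)
qed auto

lemma choose_le_power: "real (k choose j) \<le> real k ^ j"
proof (cases "j \<le> k")
  case True
  then show ?thesis
    using binomial_le_pow[OF True] by (metis of_nat_le_iff of_nat_power)
qed (simp add: binomial_eq_0)

text \<open>Written as a \<open>j\<close>-th power, the edge saving of an overlap of size
  \<open>j\<close> combines with the other factors of \<open>overlap_term_le\<close>.\<close>

lemma two_power_choose_two: "(2::real) ^ (j choose 2) = (2 powr ((real j - 1) / 2)) ^ j"
proof -
  have "real (j choose 2) = real j * (real j - 1) / 2"
    by (cases j) (auto simp: choose_two real_of_nat_div of_nat_diff algebra_simps)
  moreover have "(2 powr ((real j - 1) / 2)) ^ j = (2::real) powr ((real j - 1) / 2 * real j)"
    by (simp only: powr_powr flip: powr_realpow[OF powr_gt_zero[THEN iffD2]])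
  moreover have "(2::real) ^ (j choose 2) = 2 powr real (j choose 2)"
    by (simp add: powr_realpow)
  ultimately show ?thesis
    by (simp only: times_divide_eq_left times_divide_eq_right mult.commute)
qed

text \<open>Each overlap vertex contributes at most \<open>k\<close> for its choice,
  \<open>l / M\<close> for the vertex it replaces and \<open>2 powr ((j - 1) / 2)\<close> for the
  saved edges; the product of the three is at most \<open>b\<close>.\<close>

lemma overlap_term_le:
  fixes M b :: real
  assumes "j \<le> l" "l \<le> N" "0 < M" "M \<le> real (N - l + 1)" "0 \<le> b"
    and b: "real k * real l * 2 powr ((real j - 1) / 2) \<le> b * M"
  shows "real (k choose j) * real (N choose (l - j)) * 2 ^ (j choose 2) \<le> real (N choose l) * b ^ j"
proof -
  have "real (k choose j) * real (N choose (l - j)) * 2 ^ (j choose 2) * M ^ j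
      \<le> real k ^ j * real (N choose (l - j)) * 2 ^ (j choose 2) * M ^ j"
    using assms by (intro mult_right_mono choose_le_power) auto
  also have "\<dots> = (real (N choose (l - j)) * M ^ j) * (real k ^ j * 2 ^ (j choose 2))"
    by (simp add: mult_ac)
  also have "\<dots> \<le> (real (N choose l) * real l ^ j) * (real k ^ j * 2 ^ (j choose 2))"
    using assms by (intro mult_right_mono choose_diff_le) auto
  also have "\<dots> = real (N choose l) * (real k * real l * 2 powr ((real j - 1) / 2)) ^ j"
    by (simp add: two_power_choose_two power_mult_distrib mult_ac)
  also have "\<dots> \<le> real (N choose l) * (b * M) ^ j"
    using b by (intro mult_left_mono power_mono) auto
  also have "\<dots> = real (N choose l) * b ^ j * M ^ j"
    by (simp add: power_mult_distrib)
  finally show ?thesis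
    using assms by simp
qed

section \<open>Cliques of given size and planted overlap\<close>

definition planted :: "nat \<Rightarrow> nat set \<Rightarrow> nat set set \<Rightarrow> nat set set" where
  "planted n P E = E \<union> {e \<in> vertex_pairs n. e \<subseteq> P}"

text \<open>The expected number of \<open>l\<close>-cliques in the uniform random graph on
  \<open>N\<close> vertices. With \<open>N = n - card P\<close> it is the common yardstick for all
  counts that follow.\<close>

definition mean_cliques :: "nat \<Rightarrow> nat \<Rightarrow> real" where
  "mean_cliques N l = real (N choose l) * (1/2) ^ (l choose 2)"

definition overlap_cliques :: "nat \<Rightarrow> nat set set \<Rightarrow> nat set \<Rightarrow> nat \<Rightarrow> nat \<Rightarrow> nat set set" where
  "overlap_cliques n E P l j = {C \<in> cliques n E. card C = l \<and> card (C \<inter> P) = j}"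

lemma half_power_diff:
  assumes "b \<le> a"
  shows "(1/2 :: real) ^ (a - b) = (1/2) ^ a * 2 ^ b"
  using assms by (simp add: power_diff power_one_over field_simps)

lemma mean_cliques_pos: "l \<le> N \<Longrightarrow> 0 < mean_cliques N l"
  by (simp add: mean_cliques_def)

lemma mem_cliques_planted: "C \<in> cliques n (planted n P E) \<longleftrightarrow> C \<subseteq> {..<n} \<and> pairs C - pairs P \<subseteq> E"
  unfolding planted_def by (rule cliques_planted_iff)

lemma overlap_cliques_planted:
  "overlap_cliques n (planted n P E) P l j
    = {C \<in> {C. C \<subseteq> {..<n} \<and> card C = l \<and> card (C \<inter> P) = j}. pairs C - pairs P \<subseteq> E}"
  unfolding overlap_cliques_def mem_cliques_planted by blast

text \<open>Compared with a clique outside \<open>P\<close>, the \<open>j\<close> planted vertices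
  save \<open>j choose 2\<close> random edges but come from only \<open>card P\<close> candidates;
  the trade is a factor \<open>b\<close> per planted vertex.\<close>

lemma expected_overlap_cliques:
  assumes P: "P \<subseteq> {..<n}" and N: "N = n - card P"
    and le: "j \<le> l" "l \<le> N" and M: "0 < M" "M \<le> real (N - l + 1)" and b0: "0 \<le> b"
    and b: "real (card P) * real l * 2 powr ((real j - 1) / 2) \<le> b * M"
  shows "(\<Sum>C | C \<subseteq> {..<n} \<and> card C = l \<and> card (C \<inter> P) = j. (1/2) ^ card (pairs C - pairs P))
    \<le> mean_cliques N l * b ^ j"
proof -
  have fP: "finite P"
    using P finite_subset by blast
  have "(\<Sum>C | C \<subseteq> {..<n} \<and> card C = l \<and> card (C \<inter> P) = j. (1/2) ^ card (pairs C - pairs P))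
      = (\<Sum>C | C \<subseteq> {..<n} \<and> card C = l \<and> card (C \<inter> P) = j. (1/2 :: real) ^ ((l choose 2) - (j choose 2)))"
    by (intro sum.cong refl) (auto simp: card_pairs_Diff finite_subset)
  also have "\<dots> = real ((card P choose j) * (N choose (l - j))) * (1/2) ^ ((l choose 2) - (j choose 2))"
  proof -
    have "{..<n} \<inter> P = P" "card ({..<n} - P) = N"
      using P N fP by (auto simp: card_Diff_subset)
    then show ?thesis
      using card_subsets_overlap[of "{..<n}" j l P] le by simp
  qed
  also have "\<dots> = (real (card P choose j) * real (N choose (l - j)) * 2 ^ (j choose 2)) * (1/2) ^ (l choose 2)"
    using le by (subst half_power_diff) (auto intro: binomial_right_mono)
  also have "\<dots> \<le> (real (N choose l) * b ^ j) * (1/2) ^ (l choose 2)"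
    using assms by (intro mult_right_mono overlap_term_le[where M = M]) auto
  finally show ?thesis
    by (simp add: mean_cliques_def mult_ac)
qed

lemma prob_many_overlap_cliques:
  assumes P: "P \<subseteq> {..<n}" and N: "N = n - card P"
    and le: "j \<le> l" "l \<le> N" and M: "0 < M" "M \<le> real (N - l + 1)" and b0: "0 \<le> b"
    and b: "real (card P) * real l * 2 powr ((real j - 1) / 2) \<le> b * M" and t: "0 < t"
  shows "measure_pmf.prob (gnp_half n)
      {E. t * mean_cliques N l \<le> real (card (overlap_cliques n (planted n P E) P l j))} \<le> b ^ j / t"
proof -
  let ?X = "{C. C \<subseteq> {..<n} \<and> card C = l \<and> card (C \<inter> P) = j}"
  have "measure_pmf.prob (gnp_half n)
      {E. t * mean_cliques N l \<le> real (card {C \<in> ?X. pairs C - pairs P \<subseteq> E})}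
      \<le> (mean_cliques N l * b ^ j) / (t * mean_cliques N l)"
  proof (rule first_moment)
    show "(\<Sum>C\<in>?X. (1/2) ^ card (pairs C - pairs P)) \<le> mean_cliques N l * b ^ j"
      by (rule expected_overlap_cliques[OF P N le M b0 b])
    show "0 < t * mean_cliques N l"
      using t mean_cliques_pos[OF le(2)] by simp
    show "pairs C - pairs P \<subseteq> vertex_pairs n" if "C \<in> ?X" for C
      using that pairs_mono[of C "{..<n}"] by (auto simp: vertex_pairs_eq)
  qed simp
  then show ?thesis
    using mean_cliques_pos[OF le(2)] by (simp add: overlap_cliques_planted)
qed

text \<open>In the inner sum \<open>S\<close> takes the role of the planted clique, which makes
  \<open>overlap_term_le\<close> applicable.\<close>

lemma sum_pairs_union_le:
  assumes V: "finite V" and l: "l \<le> card V" and M: "0 < M" "M \<le> real (card V - l + 1)"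
    and b: "0 \<le> b" "b \<le> 1" "real l * real l * 2 powr ((real l - 1) / 2) \<le> b * M"
  shows "(\<Sum>S | S \<subseteq> V \<and> card S = l. \<Sum>T | T \<subseteq> V \<and> card T = l. (1/2) ^ card (pairs S \<union> pairs T))
    \<le> (1 + real l * b) * (mean_cliques (card V) l)\<^sup>2"
proof -
  let ?X = "{S. S \<subseteq> V \<and> card S = l}" and ?c = "real (card V choose l)"
  have inner: "(\<Sum>T\<in>?X. (1/2) ^ card (pairs S \<union> pairs T))
      \<le> (1/2) ^ (2 * (l choose 2)) * (?c * (1 + real l * b))" if S: "S \<in> ?X" for S
  proof -
    have fS: "finite S"
      using S V finite_subset by blast
    have "(\<Sum>T\<in>?X. (1/2) ^ card (pairs S \<union> pairs T))
        = (\<Sum>T\<in>?X. (1/2) ^ (2 * (l choose 2)) * (2::real) ^ (card (T \<inter> S) choose 2))"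
    proof (intro sum.cong refl)
      fix T assume T: "T \<in> ?X"
      then have fT: "finite T"
        using V finite_subset by blast
      have "card (pairs S \<union> pairs T) + card (pairs S \<inter> pairs T) = card (pairs S) + card (pairs T)"
        using fS fT by (metis card_Un_Int finite_pairs)
      moreover have "pairs S \<inter> pairs T = pairs (T \<inter> S)"
        by (auto simp: pairs_Int)
      moreover have "card (T \<inter> S) \<le> l"
        using T fT by (auto intro: card_mono)
      ultimately have "card (pairs S \<union> pairs T) = 2 * (l choose 2) - (card (T \<inter> S) choose 2)"
        and "(card (T \<inter> S) choose 2) \<le> 2 * (l choose 2)"
        using S T fS fT binomial_right_mono[of "card (T \<inter> S)" l 2] by (auto simp: card_pairs)
      then show "(1/2) ^ card (pairs S \<union> pairs T)
          = (1/2) ^ (2 * (l choose 2)) * (2::real) ^ (card (T \<inter> S) choose 2)"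
        by (simp only: half_power_diff)
    qed
    also have "\<dots> = (1/2) ^ (2 * (l choose 2)) * (\<Sum>T\<in>?X. (2::real) ^ (card (T \<inter> S) choose 2))"
      by (rule sum_distrib_left[symmetric])
    also have "(\<Sum>T\<in>?X. (2::real) ^ (card (T \<inter> S) choose 2))
        = (\<Sum>j\<le>l. real (l choose j) * real (card V - l choose (l - j)) * 2 ^ (j choose 2))"
    proof -
      have "card (V \<inter> S) = l" "card (V - S) = card V - l"
        using S fS by (auto simp: card_Diff_subset Int_absorb1)
      then show ?thesis
        using sum_subsets_overlap[OF V, of "\<lambda>j. 2 ^ (j choose 2)" S l] by simp
    qed
    \<comment> \<open>Overlap 0 gives the main term 1; since \<open>b \<le> 1\<close>, each of the
      other \<open>l\<close> overlaps adds at most \<open>b\<close>.\<close>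
    also have "\<dots> \<le> (\<Sum>j\<le>l. ?c * (if j = 0 then 1 else b))"
    proof (intro sum_mono)
      fix j assume j: "j \<in> {..l}"
      have "real (l choose j) * real (card V - l choose (l - j)) * 2 ^ (j choose 2)
          \<le> real (l choose j) * real (card V choose (l - j)) * 2 ^ (j choose 2)"
        by (intro mult_right_mono mult_left_mono of_nat_mono binomial_right_mono) auto
      also have "\<dots> \<le> ?c * b ^ j"
      proof (rule overlap_term_le[where M = M])
        \<comment> \<open>The hypothesis on \<open>b\<close> is stated for the largest overlap
          \<open>l\<close> and so covers every \<open>j\<close>.\<close>
        have "real l * real l * 2 powr ((real j - 1) / 2) \<le> real l * real l * 2 powr ((real l - 1) / 2)"
          using j by (intro mult_left_mono powr_mono) auto
        then show "real l * real l * 2 powr ((real j - 1) / 2) \<le> b * M"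
          using b by linarith
      qed (use j l M b in auto)
      also have "\<dots> \<le> ?c * (if j = 0 then 1 else b)"
        using b power_decreasing[of 1 j b] by (intro mult_left_mono) auto
      finally show "real (l choose j) * real (card V - l choose (l - j)) * 2 ^ (j choose 2)
          \<le> ?c * (if j = 0 then 1 else b)" .
    qed
    also have "\<dots> = ?c * (1 + real l * b)"
      unfolding sum_distrib_left[symmetric] sum.atMost_shift by simp
    finally show ?thesis
      by (simp add: mult_left_mono)
  qed
  have "(\<Sum>S\<in>?X. \<Sum>T\<in>?X. (1/2) ^ card (pairs S \<union> pairs T))
      \<le> (\<Sum>S\<in>?X. (1/2) ^ (2 * (l choose 2)) * (?c * (1 + real l * b)))"
    by (intro sum_mono inner)
  also have "\<dots> = ?c * ((1/2) ^ (2 * (l choose 2)) * (?c * (1 + real l * b)))"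
    using V by (simp add: n_subsets)
  also have "\<dots> = (1 + real l * b) * (mean_cliques (card V) l)\<^sup>2"
    by (simp add: mean_cliques_def power2_eq_square mult_2 power_add mult_ac)
  finally show ?thesis .
qed

text \<open>Cliques avoiding \<open>P\<close> contain no planted pair, so they are the cliques of a
  uniform random graph on \<open>N\<close> vertices and the second moment method applies with
  \<open>\<eta> = l * b\<close>.\<close>

lemma prob_few_disjoint_cliques:
  assumes P: "P \<subseteq> {..<n}" and N: "N = n - card P"
    and l: "l \<le> N" and M: "0 < M" "M \<le> real (N - l + 1)"
    and b: "0 \<le> b" "b \<le> 1" "real l * real l * 2 powr ((real l - 1) / 2) \<le> b * M"
  shows "measure_pmf.prob (gnp_half n)
      {E. real (card (overlap_cliques n (planted n P E) P l 0)) < mean_cliques N l / 2} \<le> 4 * (real l * b)"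
proof -
  let ?V = "{..<n} - P"
  let ?X = "{C. C \<subseteq> ?V \<and> card C = l}"
  have fP: "finite P"
    using P finite_subset by blast
  have cV: "card ?V = N"
    using P N fP by (auto simp: card_Diff_subset)
  have eq: "overlap_cliques n (planted n P E) P l 0 = {C \<in> ?X. pairs C \<subseteq> E}" for E
  proof -
    have "pairs C - pairs P = pairs C" if "C \<subseteq> ?V" for C
      using that by (auto simp: pairs_def card_2_iff)
    moreover have "C \<subseteq> ?V \<longleftrightarrow> C \<subseteq> {..<n} \<and> card (C \<inter> P) = 0" for C
      using fP by auto
    ultimately show ?thesis
      unfolding overlap_cliques_planted by (intro Collect_cong) (simp, metis)
  qed
  have "measure_pmf.prob (gnp_half n) {E. real (card {C \<in> ?X. pairs C \<subseteq> E}) < mean_cliques N l / 2}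
      \<le> 4 * (real l * b)"
  proof (rule second_moment)
    show "finite ?X" by simp
    show "pairs C \<subseteq> vertex_pairs n" if "C \<in> ?X" for C
      unfolding vertex_pairs_eq using that by (intro pairs_mono) auto
    have "(\<Sum>C\<in>?X. (1/2) ^ card (pairs C)) = (\<Sum>C\<in>?X. (1/2 :: real) ^ (l choose 2))"
      by (intro sum.cong refl) (auto simp: card_pairs finite_subset)
    also have "\<dots> = mean_cliques N l"
      using n_subsets[of ?V l] cV by (simp add: mean_cliques_def)
    finally show "mean_cliques N l = (\<Sum>C\<in>?X. (1/2) ^ card (pairs C))" by simp
    show "0 < mean_cliques N l"
      by (rule mean_cliques_pos[OF l])
    show "(\<Sum>x\<in>?X. \<Sum>y\<in>?X. (1/2) ^ card (pairs x \<union> pairs y)) \<le> (1 + real l * b) * (mean_cliques N l)\<^sup>2"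
      using sum_pairs_union_le[of ?V l M b] l M b cV by simp
  qed
  then show ?thesis
    by (simp only: eq)
qed

section \<open>The expected number of gateways\<close>

lemma gateways_attachment:
  assumes "C \<in> gateways n (planted n P E) P q r s"
  shows "\<exists>D I. C \<subseteq> {..<n} \<and> card C = q \<and> card (C \<inter> P) < s \<and> D \<subseteq> {..<n} - C \<and> card D = r \<and>
    I \<subseteq> C \<and> card I = q - r \<and> pairs C - pairs P \<subseteq> E \<and> (\<lambda>(d, i). {d, i}) ` (D \<times> I) - pairs P \<subseteq> E"
proof -
  obtain C' where C: "C \<subseteq> {..<n}" "card C = q" "card (C \<inter> P) < s" "pairs C - pairs P \<subseteq> E"
    and C': "C' \<subseteq> {..<n}" "pairs C' - pairs P \<subseteq> E" "q \<le> card C'" "card (C' - C) = r"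
    using assms by (auto simp: gateways_def mem_cliques_planted)
  \<comment> \<open>The new vertices are \<open>D = C' - C\<close>. As \<open>C'\<close> keeps at
    least \<open>q - r\<close> vertices of \<open>C\<close>, a subset \<open>I\<close> of exactly
    that size can be chosen, which fixes the number of edges to be counted.\<close>
  have "card C' = card (C' - C) + card (C' \<inter> C)"
    using C' finite_subset[of C' "{..<n}"] by (metis card_Int_Diff add.commute finite_lessThan)
  then have "q - r \<le> card (C' \<inter> C)"
    using C' by simp
  then obtain I where I: "I \<subseteq> C' \<inter> C" "card I = q - r"
    using obtain_subset_with_card_n by metis
  have "(\<lambda>(d, i). {d, i}) ` ((C' - C) \<times> I) \<subseteq> pairs C'"
  proof clarify
    fix d i assume "d \<in> C'" "d \<notin> C" "i \<in> I"
    then have "d \<noteq> i" "{d, i} \<subseteq> C'"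
      using I by auto
    then show "{d, i} \<in> pairs C'"
      by (simp add: pairs_def)
  qed
  then show ?thesis
    using C C' I by (intro exI[of _ "C' - C"] exI[of _ I]) auto
qed

text \<open>A pair between \<open>D\<close> and \<open>I\<close> is free only if both its ends are
  planted, which happens for at most \<open>card (D \<inter> P) * u\<close> pairs. The rest are
  distinct and have one end outside \<open>C\<close>, so they add to the pairs inside
  \<open>C\<close>.\<close>

lemma card_gateway_edges:
  assumes fin: "finite C" "finite D" and disj: "D \<inter> C = {}" and I: "I \<subseteq> C"
    and s: "card (I \<inter> P) \<le> u"
  shows "card (pairs C - pairs P) + (card D * card I - card (D \<inter> P) * u)
    \<le> card ((pairs C - pairs P) \<union> ((\<lambda>(d, i). {d, i}) ` (D \<times> I) - pairs P))"
proof -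
  let ?f = "\<lambda>(d, i). {d, i}" and ?X = "D \<times> I - (D \<inter> P) \<times> (I \<inter> P)"
  have fI: "finite I"
    using fin I finite_subset by blast
  have "?f ` (D \<times> I) - pairs P = ?f ` ?X"
    using disj I by (fastforce simp: pairs_def card_2_iff doubleton_eq_iff image_iff)
  moreover have "inj_on ?f ?X"
    using disj I by (auto simp: inj_on_def doubleton_eq_iff)
  ultimately have "card (?f ` (D \<times> I) - pairs P) = card ?X"
    by (simp add: card_image)
  also have "\<dots> = card D * card I - card (D \<inter> P) * card (I \<inter> P)"
    using fin fI by (subst card_Diff_subset) (auto simp: card_cartesian_product)
  finally have "card D * card I - card (D \<inter> P) * u \<le> card (?f ` (D \<times> I) - pairs P)"
    using s by (simp add: diff_le_mono2)
  moreover have "card ((pairs C - pairs P) \<union> (?f ` (D \<times> I) - pairs P))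
      = card (pairs C - pairs P) + card (?f ` (D \<times> I) - pairs P)"
    using fin fI disj by (intro card_Un_disjoint) (auto simp: pairs_def)
  ultimately show ?thesis
    by simp
qed

text \<open>Split by the number \<open>t\<close> of planted vertices in \<open>D\<close>. An
  unplanted vertex costs a factor \<open>n * (1/2) ^ b\<close>, a planted one
  \<open>k * 2 ^ u * (1/2) ^ b\<close>; both are at most \<open>\<theta>\<close>, and there are
  \<open>r + 1\<close> values of \<open>t\<close>.\<close>

lemma sum_attachments_le:
  fixes \<theta> :: real
  assumes V: "finite V" "card V \<le> n" and k: "card (V \<inter> P) \<le> k" and u: "u \<le> b"
    and \<theta>: "real n * (1/2) ^ b \<le> \<theta>" "real k * 2 ^ u * (1/2) ^ b \<le> \<theta>"
  shows "(\<Sum>D | D \<subseteq> V \<and> card D = r. (1/2) ^ (r * b - card (D \<inter> P) * u)) \<le> (real r + 1) * \<theta> ^ r"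
proof -
  have "0 \<le> \<theta>"
    by (rule order.trans[OF _ \<theta>(1)]) simp
  have "(\<Sum>D | D \<subseteq> V \<and> card D = r. (1/2 :: real) ^ (r * b - card (D \<inter> P) * u))
      = (\<Sum>t\<le>r. real (card (V \<inter> P) choose t) * real (card (V - P) choose (r - t)) * (1/2) ^ (r * b - t * u))"
    by (rule sum_subsets_overlap[OF V(1)])
  also have "\<dots> \<le> (\<Sum>t\<le>r. \<theta> ^ r)"
  proof (intro sum_mono)
    fix t assume "t \<in> {..r}"
    then have t: "t \<le> r" by simp
    have "real (card (V \<inter> P) choose t) \<le> real k ^ t"
      using k by (intro order.trans[OF choose_le_power] power_mono) auto
    moreover have "real (card (V - P) choose (r - t)) \<le> real n ^ (r - t)"
      using V card_mono[of V "V - P"] by (intro order.trans[OF choose_le_power] power_mono) auto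
    ultimately have "real (card (V \<inter> P) choose t) * real (card (V - P) choose (r - t)) * (1/2) ^ (r * b - t * u)
        \<le> real k ^ t * real n ^ (r - t) * (1/2) ^ (r * b - t * u)"
      by (intro mult_right_mono mult_mono) auto
    also have "\<dots> = (real k * 2 ^ u * (1/2) ^ b) ^ t * (real n * (1/2) ^ b) ^ (r - t)"
    proof -
      have "(1/2 :: real) ^ (r * b) = ((1/2) ^ b) ^ t * ((1/2) ^ b) ^ (r - t)"
        using t by (simp add: mult.commute power_mult flip: power_add)
      moreover have "(2::real) ^ (t * u) = (2 ^ u) ^ t"
        by (metis mult.commute power_mult)
      moreover have "(1/2 :: real) ^ (r * b - t * u) = (1/2) ^ (r * b) * 2 ^ (t * u)"
        using t u by (intro half_power_diff mult_mono) auto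
      ultimately show ?thesis
        by (simp only: power_mult_distrib mult_ac)
    qed
    also have "\<dots> \<le> \<theta> ^ t * \<theta> ^ (r - t)"
      using \<theta> \<open>0 \<le> \<theta>\<close> by (intro mult_mono power_mono) auto
    also have "\<dots> = \<theta> ^ r"
      using t by (simp flip: power_add)
    finally show "real (card (V \<inter> P) choose t) * real (card (V - P) choose (r - t)) * (1/2) ^ (r * b - t * u)
        \<le> \<theta> ^ r" .
  qed
  also have "\<dots> = (real r + 1) * \<theta> ^ r"
    by (simp add: add.commute)
  finally show ?thesis .
qed

lemma sum_Sigma_Times:
  assumes "finite A" "\<And>x. x \<in> A \<Longrightarrow> finite (B x)" "\<And>x. x \<in> A \<Longrightarrow> finite (C x)"
  shows "(\<Sum>x\<in>(SIGMA x:A. B x \<times> C x). g x) = (\<Sum>x\<in>A. \<Sum>y\<in>B x. \<Sum>z\<in>C x. g (x, y, z))"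
proof -
  have "(\<Sum>x\<in>A. \<Sum>y\<in>B x. \<Sum>z\<in>C x. g (x, y, z)) = (\<Sum>x\<in>A. \<Sum>yz\<in>B x \<times> C x. g (x, yz))"
    by (simp add: sum.cartesian_product split_def)
  also have "\<dots> = (\<Sum>x\<in>(SIGMA x:A. B x \<times> C x). g x)"
    using assms by (subst sum.Sigma) (auto simp: split_def)
  finally show ?thesis ..
qed

text \<open>First moment over triples \<open>(C, D, I)\<close>: the factor \<open>s\<close> comes
  from the possible planted overlaps of \<open>C\<close>, \<open>2 ^ q\<close> from the choice of
  \<open>I\<close>, and \<open>(r + 1) * \<theta> ^ r\<close> from the choice of \<open>D\<close>
  and the edges it requires.\<close>

lemma prob_many_gateways:
  assumes P: "P \<subseteq> {..<n}" and N: "N = n - card P"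
    and q: "q \<le> N" and s: "0 < s" "s - 1 \<le> q - r"
    and M: "0 < M" "M \<le> real (N - q + 1)"
    and b: "real (card P) * real q * 2 powr ((real s - 1) / 2) \<le> M"
    and \<theta>: "real n * (1/2) ^ (q - r) \<le> \<theta>" "real (card P) * 2 ^ (s - 1) * (1/2) ^ (q - r) \<le> \<theta>"
    and t: "0 < t"
  shows "measure_pmf.prob (gnp_half n)
      {E. t * mean_cliques N q \<le> real (card (gateways n (planted n P E) P q r s))}
    \<le> real s * 2 ^ q * (real r + 1) * \<theta> ^ r / t"
proof -
  let ?A = "{C. C \<subseteq> {..<n} \<and> card C = q \<and> card (C \<inter> P) < s}"
  let ?D = "\<lambda>C. {D. D \<subseteq> {..<n} - C \<and> card D = r}" and ?I = "\<lambda>C. {I. I \<subseteq> C \<and> card I = q - r}"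
  let ?X = "SIGMA C:?A. ?D C \<times> ?I C"
  let ?F = "\<lambda>(C, D, I). (pairs C - pairs P) \<union> ((\<lambda>(d, i). {d, i}) ` (D \<times> I) - pairs P)"
  have finA: "finite ?A" and finD: "finite (?D C)" for C
    by simp_all
  have finC: "finite C" if "C \<in> ?A" for C
    using that finite_subset by blast
  have finI: "finite (?I C)" if "C \<in> ?A" for C
    using finC[OF that] by simp
  have finX: "finite ?X"
    using finA finD finI by (intro finite_SigmaI finite_cartesian_product) auto
  have "0 \<le> \<theta>"
    by (rule order.trans[OF _ \<theta>(1)]) simp
  have inner: "(\<Sum>D\<in>?D C. \<Sum>I\<in>?I C. (1/2) ^ card (?F (C, D, I)))
      \<le> (1/2) ^ card (pairs C - pairs P) * (2 ^ q * ((real r + 1) * \<theta> ^ r))" if C: "C \<in> ?A" for C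
  proof -
    have "(\<Sum>D\<in>?D C. \<Sum>I\<in>?I C. (1/2 :: real) ^ card (?F (C, D, I)))
        \<le> (\<Sum>D\<in>?D C. \<Sum>I\<in>?I C. (1/2) ^ (card (pairs C - pairs P) + (r * (q - r) - card (D \<inter> P) * (s - 1))))"
    proof (intro sum_mono power_decreasing)
      fix D I assume DI: "D \<in> ?D C" "I \<in> ?I C"
      have "card (I \<inter> P) \<le> card (C \<inter> P)"
        using DI finC[OF C] by (intro card_mono) auto
      then have "card (I \<inter> P) \<le> s - 1"
        using C by auto
      moreover have "finite D"
        using DI finite_subset by blast
      ultimately show "card (pairs C - pairs P) + (r * (q - r) - card (D \<inter> P) * (s - 1)) \<le> card (?F (C, D, I))"
        using card_gateway_edges[of C D I P "s - 1"] DI finC[OF C] by auto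
    qed auto
    also have "\<dots> = (1/2) ^ card (pairs C - pairs P) *
        (real (q choose (q - r)) * (\<Sum>D\<in>?D C. (1/2) ^ (r * (q - r) - card (D \<inter> P) * (s - 1))))"
      using n_subsets[OF finC[OF C], of "q - r"] C
      by (simp add: power_add sum_distrib_left mult_ac)
    also have "\<dots> \<le> (1/2) ^ card (pairs C - pairs P) * (2 ^ q * ((real r + 1) * \<theta> ^ r))"
    proof (intro mult_left_mono mult_mono)
      show "real (q choose (q - r)) \<le> 2 ^ q"
        by (metis binomial_le_pow2 of_nat_le_iff of_nat_numeral of_nat_power)
      have "card ({..<n} - C) \<le> n"
        using card_mono[of "{..<n}" "{..<n} - C"] by simp
      moreover have "card (({..<n} - C) \<inter> P) \<le> card P"
        using P finite_subset by (intro card_mono) auto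
      ultimately show "(\<Sum>D\<in>?D C. (1/2) ^ (r * (q - r) - card (D \<inter> P) * (s - 1))) \<le> (real r + 1) * \<theta> ^ r"
        using s \<theta> by (intro sum_attachments_le) auto
    qed (auto intro!: sum_nonneg)
    finally show ?thesis .
  qed
  \<comment> \<open>For each overlap \<open>j < s\<close>, \<open>expected_overlap_cliques\<close>
    with base 1 bounds the contribution by \<open>mean_cliques N q\<close>.\<close>
  have outer: "(\<Sum>C\<in>?A. (1/2) ^ card (pairs C - pairs P)) \<le> real s * mean_cliques N q"
  proof -
    have "(\<Sum>C\<in>?A. (1/2 :: real) ^ card (pairs C - pairs P))
        = (\<Sum>j<s. \<Sum>C\<in>{C \<in> ?A. card (C \<inter> P) = j}. (1/2) ^ card (pairs C - pairs P))"
      using finA by (intro sum.group[symmetric]) auto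
    also have "\<dots> \<le> (\<Sum>j<s. mean_cliques N q)"
    proof (intro sum_mono)
      fix j assume j: "j \<in> {..<s}"
      have "{C \<in> ?A. card (C \<inter> P) = j} = {C. C \<subseteq> {..<n} \<and> card C = q \<and> card (C \<inter> P) = j}"
        using j by auto
      moreover have "real (card P) * real q * 2 powr ((real j - 1) / 2)
          \<le> real (card P) * real q * 2 powr ((real s - 1) / 2)"
        using j by (intro mult_left_mono powr_mono) auto
      then have "real (card P) * real q * 2 powr ((real j - 1) / 2) \<le> 1 * M"
        using b by linarith
      moreover have "j \<le> q"
        using j s by auto
      ultimately show "(\<Sum>C\<in>{C \<in> ?A. card (C \<inter> P) = j}. (1/2) ^ card (pairs C - pairs P)) \<le> mean_cliques N q"
        using expected_overlap_cliques[OF P N _ q M, of j 1] by simp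
    qed
    finally show ?thesis by simp
  qed
  have "(\<Sum>x\<in>?X. (1/2 :: real) ^ card (?F x))
      = (\<Sum>C\<in>?A. \<Sum>D\<in>?D C. \<Sum>I\<in>?I C. (1/2) ^ card (?F (C, D, I)))"
    by (rule sum_Sigma_Times[OF finA finD finI])
  also have "\<dots> \<le> (\<Sum>C\<in>?A. (1/2) ^ card (pairs C - pairs P) * (2 ^ q * ((real r + 1) * \<theta> ^ r)))"
    by (intro sum_mono inner)
  also have "\<dots> = (\<Sum>C\<in>?A. (1/2) ^ card (pairs C - pairs P)) * (2 ^ q * ((real r + 1) * \<theta> ^ r))"
    by (rule sum_distrib_right[symmetric])
  also have "\<dots> \<le> real s * mean_cliques N q * (2 ^ q * ((real r + 1) * \<theta> ^ r))"
    using \<open>0 \<le> \<theta>\<close> by (intro mult_right_mono outer) auto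
  finally have expect: "(\<Sum>x\<in>?X. (1/2 :: real) ^ card (?F x))
      \<le> real s * mean_cliques N q * (2 ^ q * ((real r + 1) * \<theta> ^ r))" .
  \<comment> \<open>Every gateway is the first component of at least one triple counted on the
    right.\<close>
  have le: "card (gateways n (planted n P E) P q r s) \<le> card {x \<in> ?X. ?F x \<subseteq> E}" for E
  proof -
    have "gateways n (planted n P E) P q r s \<subseteq> fst ` {x \<in> ?X. ?F x \<subseteq> E}"
    proof
      fix C assume "C \<in> gateways n (planted n P E) P q r s"
      from gateways_attachment[OF this] obtain D I where
        *: "C \<subseteq> {..<n}" "card C = q" "card (C \<inter> P) < s" "D \<subseteq> {..<n} - C" "card D = r"
          "I \<subseteq> C" "card I = q - r" "pairs C - pairs P \<subseteq> E" "(\<lambda>(d, i). {d, i}) ` (D \<times> I) - pairs P \<subseteq> E"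
        by (elim exE conjE)
      have "C \<in> ?A" "D \<in> ?D C" "I \<in> ?I C"
        using * by simp_all
      moreover have "?F (C, D, I) \<subseteq> E"
        unfolding prod.case using *(8,9) by (rule Un_least)
      ultimately have "(C, D, I) \<in> {x \<in> ?X. ?F x \<subseteq> E}"
        by (simp only: mem_Collect_eq mem_Sigma_iff simp_thms)
      then show "C \<in> fst ` {x \<in> ?X. ?F x \<subseteq> E}"
        by (rule rev_image_eqI) simp
    qed
    moreover have "finite {x \<in> ?X. ?F x \<subseteq> E}"
      by (rule finite_subset[OF _ finX]) blast
    ultimately show ?thesis
      by (rule surj_card_le[rotated])
  qed
  have "measure_pmf.prob (gnp_half n)
      {E. t * mean_cliques N q \<le> real (card (gateways n (planted n P E) P q r s))}
      \<le> measure_pmf.prob (gnp_half n) {E. t * mean_cliques N q \<le> real (card {x \<in> ?X. ?F x \<subseteq> E})}"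
  proof (rule measure_pmf.finite_measure_mono)
    show "{E. t * mean_cliques N q \<le> real (card (gateways n (planted n P E) P q r s))}
        \<subseteq> {E. t * mean_cliques N q \<le> real (card {x \<in> ?X. ?F x \<subseteq> E})}"
      by (intro Collect_mono impI, erule order.trans) (rule of_nat_mono[OF le])
  qed simp
  also have "\<dots> \<le> real s * mean_cliques N q * (2 ^ q * ((real r + 1) * \<theta> ^ r)) / (t * mean_cliques N q)"
  proof (rule first_moment[OF finX _ _ expect])
    show "0 < t * mean_cliques N q"
      using t mean_cliques_pos[OF q] by simp
    fix x assume "x \<in> ?X"
    then obtain C D I where x: "x = (C, D, I)" "C \<subseteq> {..<n}" "D \<subseteq> {..<n} - C" "I \<subseteq> C"
      by auto
    have "(\<lambda>(d, i). {d, i}) ` (D \<times> I) \<subseteq> pairs {..<n}"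
    proof clarify
      fix d i assume "d \<in> D" "i \<in> I"
      then have "d \<noteq> i" "{d, i} \<subseteq> {..<n}"
        using x by auto
      then show "{d, i} \<in> pairs {..<n}"
        by (simp add: pairs_def)
    qed
    then show "?F x \<subseteq> vertex_pairs n"
      using pairs_mono[OF x(2)] unfolding vertex_pairs_eq x(1) by auto
  qed
  also have "\<dots> = real s * 2 ^ q * (real r + 1) * \<theta> ^ r / t"
    using mean_cliques_pos[OF q] by (simp add: mult_ac)
  finally show ?thesis .
qed

section \<open>Typical graphs\<close>

text \<open>The ratio of consecutive means is \<open>(N - l) / (Suc l * 2 ^ l)\<close>, which is at
  most 1 once \<open>N \<le> 2 ^ l\<close>. This lets levels above \<open>q\<close> be compared with
  level \<open>q\<close>.\<close>

lemma mean_cliques_decreasing: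
  assumes "N \<le> 2 ^ q" "q \<le> l"
  shows "mean_cliques N l \<le> mean_cliques N q"
  using assms(2)
proof (induction l rule: dec_induct)
  case (step l)
  have "real (N choose Suc l) \<le> real (Suc l) * real (N choose Suc l)"
    by (simp add: mult_le_cancel_right1)
  also have "\<dots> = real (N choose l) * real (N - l)"
    by (metis binomial_absorb_comp binomial_absorption mult.commute of_nat_mult)
  also have "\<dots> \<le> real (N choose l) * 2 ^ l"
  proof (rule mult_left_mono)
    have "N - l \<le> 2 ^ l"
      using assms(1) power_increasing[OF step(1), of "2 :: nat"] by linarith
    then show "real (N - l) \<le> 2 ^ l"
      by (metis of_nat_le_iff of_nat_numeral of_nat_power)
  qed simp
  finally have "real (N choose Suc l) * (1/2) ^ (Suc l choose 2)
      \<le> real (N choose l) * 2 ^ l * (1/2) ^ (Suc l choose 2)"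
    by (rule mult_right_mono) simp
  also have "Suc l choose 2 = l + (l choose 2)"
    by (simp add: numeral_2_eq_2)
  also have "real (N choose l) * 2 ^ l * (1/2) ^ (l + (l choose 2)) = mean_cliques N l"
    by (simp add: mean_cliques_def power_add power_one_over)
  finally show ?case
    using step.IH by (simp add: mean_cliques_def numeral_2_eq_2)
qed simp

text \<open>These conditions mention the graph and \<open>P\<close> only, so a single event serves
  all \<open>h\<close>, \<open>\<beta>\<close>, \<open>Z\<close>, \<open>m\<close> and
  \<open>a\<close> simultaneously.\<close>

definition typical ::
  "nat \<Rightarrow> nat set \<Rightarrow> nat \<Rightarrow> nat \<Rightarrow> nat \<Rightarrow> real \<Rightarrow> real \<Rightarrow> nat set set \<Rightarrow> bool" where
  "typical n P q r s y g G \<longleftrightarrow>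
     (\<forall>l\<le>q. mean_cliques (n - card P) l / 2 \<le> real (card (overlap_cliques n G P l 0))) \<and>
     (\<forall>l\<le>q + r. real (card (overlap_cliques n G P l s)) \<le> y * mean_cliques (n - card P) l) \<and>
     real (card (gateways n G P q r s)) \<le> g * mean_cliques (n - card P) q"

text \<open>Union bound over the levels up to \<open>q\<close> for disjoint cliques, the levels up
  to \<open>q + r\<close> for overlap \<open>s\<close>, and the gateway count. The hypotheses on
  \<open>b\<close> and \<open>c\<close> at the largest size cover the smaller sizes.\<close>

lemma prob_typical:
  assumes P: "P \<subseteq> {..<n}" and N: "N = n - card P"
    and le: "q + r \<le> N" "0 < s" "s \<le> q - r + 1"
    and M: "0 < M" "M \<le> real (N - (q + r) + 1)"
    and b: "0 \<le> b" "b \<le> 1" "real q * real q * 2 powr ((real q - 1) / 2) \<le> b * M"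
    and c: "0 \<le> c" "c \<le> 1" "real (card P) * real (q + r) * 2 powr ((real s - 1) / 2) \<le> c * M"
    and \<theta>: "real n * (1/2) ^ (q - r) \<le> \<theta>" "real (card P) * 2 ^ (s - 1) * (1/2) ^ (q - r) \<le> \<theta>"
    and pos: "0 < y" "0 < g"
  shows "1 - (real (q + 1) * (4 * (real q * b)) + real (q + r + 1) * (c ^ s / y)
      + real s * 2 ^ q * (real r + 1) * \<theta> ^ r / g)
    \<le> measure_pmf.prob (gnp_half n) {E. typical n P q r s y g (planted n P E)}"
proof -
  let ?p = "measure_pmf.prob (gnp_half n)"
  let ?few = "\<lambda>l. {E. real (card (overlap_cliques n (planted n P E) P l 0)) < mean_cliques N l / 2}"
  let ?many = "\<lambda>l. {E. y * mean_cliques N l \<le> real (card (overlap_cliques n (planted n P E) P l s))}"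
  let ?gate = "{E. g * mean_cliques N q \<le> real (card (gateways n (planted n P E) P q r s))}"
  have few: "?p (?few l) \<le> 4 * (real q * b)" if l: "l \<le> q" for l
  proof -
    have "real l * real l * 2 powr ((real l - 1) / 2) \<le> real q * real q * 2 powr ((real q - 1) / 2)"
      using l by (intro mult_mono powr_mono) auto
    then have "real l * real l * 2 powr ((real l - 1) / 2) \<le> b * M"
      using b by linarith
    then have "?p (?few l) \<le> 4 * (real l * b)"
      using l le M b by (intro prob_few_disjoint_cliques[OF P N _ M(1)]) auto
    also have "\<dots> \<le> 4 * (real q * b)"
      using l b by (intro mult_left_mono mult_right_mono) auto
    finally show ?thesis .
  qed
  have many: "?p (?many l) \<le> c ^ s / y" if l: "l \<le> q + r" for l
  proof (cases "s \<le> l")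
    case True
    have "real (card P) * real l * 2 powr ((real s - 1) / 2)
        \<le> real (card P) * real (q + r) * 2 powr ((real s - 1) / 2)"
      using l by (intro mult_mono powr_mono) auto
    then have "real (card P) * real l * 2 powr ((real s - 1) / 2) \<le> c * M"
      using c by linarith
    then show ?thesis
      using l le M c pos True by (intro prob_many_overlap_cliques[OF P N _ _ M(1)]) auto
  next
    case False
    have "overlap_cliques n G P l s = {}" for G
    proof -
      have "card (C \<inter> P) \<le> card C" if "C \<in> cliques n G" for C
        using finite_clique[OF that] by (intro card_mono) auto
      then show ?thesis
        using False by (fastforce simp: overlap_cliques_def)
    qed
    \<comment> \<open>A level below \<open>s\<close> contains no such clique, and its threshold is
      positive, so the bad event is empty.\<close>
    then have "?many l = {}"
      using mean_cliques_pos[of l N] pos l le by (auto simp: not_le)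
    then show ?thesis
      using pos c by simp
  qed
  have gate: "?p ?gate \<le> real s * 2 ^ q * (real r + 1) * \<theta> ^ r / g"
  proof -
    have "real (card P) * real q * 2 powr ((real s - 1) / 2)
        \<le> real (card P) * real (q + r) * 2 powr ((real s - 1) / 2)"
      by (intro mult_mono powr_mono) auto
    also have "\<dots> \<le> c * M" by fact
    also have "\<dots> \<le> M"
      using c M by (simp add: mult_le_cancel_right1)
    finally show ?thesis
      using le M \<theta> pos by (intro prob_many_gateways[OF P N _ _ _ M(1)]) auto
  qed
  let ?U = "(\<Union>l\<in>{..q}. ?few l) \<union> (\<Union>l\<in>{..q + r}. ?many l) \<union> ?gate"
  have union: "?p ?U \<le> ?p (\<Union>l\<in>{..q}. ?few l) + ?p (\<Union>l\<in>{..q + r}. ?many l) + ?p ?gate"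
    using measure_Un_le[of "(\<Union>l\<in>{..q}. ?few l) \<union> (\<Union>l\<in>{..q + r}. ?many l)" "measure_pmf (gnp_half n)" ?gate]
      measure_Un_le[of "\<Union>l\<in>{..q}. ?few l" "measure_pmf (gnp_half n)" "\<Union>l\<in>{..q + r}. ?many l"] by simp
  have "?p (\<Union>l\<in>{..q}. ?few l) \<le> (\<Sum>l\<in>{..q}. ?p (?few l))"
    by (intro measure_pmf.finite_measure_subadditive_finite) auto
  also have "\<dots> \<le> real (q + 1) * (4 * (real q * b))"
    using few by (intro order.trans[OF sum_bounded_above[where K = "4 * (real q * b)"]]) auto
  finally have few_sum: "?p (\<Union>l\<in>{..q}. ?few l) \<le> real (q + 1) * (4 * (real q * b))" .
  have "?p (\<Union>l\<in>{..q + r}. ?many l) \<le> (\<Sum>l\<in>{..q + r}. ?p (?many l))"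
    by (intro measure_pmf.finite_measure_subadditive_finite) auto
  also have "\<dots> \<le> real (q + r + 1) * (c ^ s / y)"
    using many by (intro order.trans[OF sum_bounded_above[where K = "c ^ s / y"]]) auto
  finally have many_sum: "?p (\<Union>l\<in>{..q + r}. ?many l) \<le> real (q + r + 1) * (c ^ s / y)" .
  have U: "?p ?U \<le> real (q + 1) * (4 * (real q * b)) + real (q + r + 1) * (c ^ s / y)
      + real s * 2 ^ q * (real r + 1) * \<theta> ^ r / g"
    using union few_sum many_sum gate by linarith
  have "1 - ?p ?U = ?p (UNIV - ?U)"
    by (subst measure_pmf.prob_compl[symmetric]) auto
  also have "\<dots> \<le> ?p {E. typical n P q r s y g (planted n P E)}"
    using N by (intro measure_pmf.finite_measure_mono) (auto simp: typical_def not_less not_le intro: less_imp_le)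
  finally show ?thesis
    using U by linarith
qed

text \<open>The edges and the planted set are independent, so the law is a mixture over
  \<open>P\<close>; a lower bound uniform in \<open>P\<close> survives averaging.\<close>

lemma prob_planted_ge:
  assumes "k \<le> n"
    and ge: "\<And>P. P \<subseteq> {..<n} \<Longrightarrow> card P = k \<Longrightarrow> c \<le> measure_pmf.prob (gnp_half n) {E. (planted n P E, P) \<in> S}"
  shows "c \<le> measure_pmf.prob (planted_clique_pmf n k) S"
proof -
  let ?K = "{S. S \<subseteq> {..<n} \<and> card S = k}"
  have "?K \<noteq> {}"
    using obtain_subset_with_card_n[of k "{..<n}"] assms by auto
  then have supp: "set_pmf (pmf_of_set ?K) = ?K"
    by (intro set_pmf_of_set) auto
  have "planted_clique_pmf n k
      = bind_pmf (pmf_of_set ?K) (\<lambda>P. map_pmf (\<lambda>E. (planted n P E, P)) (gnp_half n))"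
    unfolding planted_clique_pmf_def pair_pmf_def map_bind_pmf planted_def map_pmf_def bind_assoc_pmf bind_return_pmf
    by (subst bind_commute_pmf) simp
  then have "measure_pmf.prob (planted_clique_pmf n k) S
      = measure_pmf.expectation (pmf_of_set ?K) (\<lambda>P. measure_pmf.prob (gnp_half n) {E. (planted n P E, P) \<in> S})"
    by (simp add: measure_bind_pmf vimage_def)
  also have "c \<le> \<dots>"
  proof (rule measure_pmf.integral_ge_const)
    show "integrable (measure_pmf (pmf_of_set ?K)) (\<lambda>P. measure_pmf.prob (gnp_half n) {E. (planted n P E, P) \<in> S})"
      by (rule measure_pmf.integrable_const_bound[where B = 1]) auto
    show "AE P in pmf_of_set ?K. c \<le> measure_pmf.prob (gnp_half n) {E. (planted n P E, P) \<in> S}"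
      unfolding AE_measure_pmf_iff supp using ge by auto
  qed
  finally show ?thesis .
qed

section \<open>The weight ratio of the barrier to the small cliques\<close>

lemma sum_over_levels:
  fixes w :: "nat \<Rightarrow> real"
  shows "(\<Sum>C | C \<in> cliques n G \<and> card C \<le> m \<and> card (C \<inter> P) = j. w (card C))
    = (\<Sum>l\<le>m. w l * real (card (overlap_cliques n G P l j)))"
proof -
  let ?X = "{C. C \<in> cliques n G \<and> card C \<le> m \<and> card (C \<inter> P) = j}"
  have fin: "finite ?X"
    by (rule finite_subset[OF _ finite_cliques[of n G]]) auto
  have "(\<Sum>C\<in>?X. w (card C)) = (\<Sum>l\<le>m. \<Sum>C\<in>{C \<in> ?X. card C = l}. w (card C))"
    using fin by (intro sum.group[symmetric]) auto
  also have "\<dots> = (\<Sum>l\<le>m. w l * real (card (overlap_cliques n G P l j)))"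
  proof (intro sum.cong refl)
    fix l assume "l \<in> {..m}"
    then have "{C \<in> ?X. card C = l} = overlap_cliques n G P l j"
      by (auto simp: overlap_cliques_def)
    then have "(\<Sum>C\<in>{C \<in> ?X. card C = l}. w (card C)) = (\<Sum>C\<in>overlap_cliques n G P l j. w l)"
      by (auto simp: overlap_cliques_def intro!: sum.cong)
    then show "(\<Sum>C\<in>{C \<in> ?X. card C = l}. w (card C)) = w l * real (card (overlap_cliques n G P l j))"
      by simp
  qed
  finally show ?thesis .
qed

text \<open>Gateways are compared with disjoint cliques at level \<open>q\<close>, and
  overlap-\<open>s\<close> cliques up to level \<open>q\<close> with disjoint cliques of the same
  size. Each of the \<open>r\<close> levels above is compared with level \<open>q\<close>, where
  \<open>W\<close> pays for the change of weight. The factors 2 stem from the lower bound by half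
  the mean.\<close>

lemma typical_bottleneck:
  assumes ty: "typical n P q r s y g G" and N: "n - card P \<le> 2 ^ q" "q + r \<le> n - card P"
    and nn: "0 < s" "0 \<le> y" "0 \<le> g"
    and w: "\<And>l. 0 < w l" "\<And>l. q < l \<Longrightarrow> l \<le> q + r \<Longrightarrow> w l \<le> W * w q"
  shows "(\<Sum>C\<in>barrier n G P q r s. w (card C))
    \<le> (2 * g + 2 * y + 2 * real r * y * W) * (\<Sum>C\<in>small_cliques n G P q s. w (card C))"
proof -
  let ?\<mu> = "mean_cliques (n - card P)"
  define A where "A = (\<Sum>C\<in>small_cliques n G P q s. w (card C))"
  have w0: "0 \<le> w l" for l
    using w(1)[of l] by simp
  have \<mu>0: "0 \<le> ?\<mu> l" for l
    by (simp add: mean_cliques_def)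
  have "(\<Sum>l\<le>q. w l * (?\<mu> l / 2)) \<le> (\<Sum>l\<le>q. w l * real (card (overlap_cliques n G P l 0)))"
    using ty w0 by (intro sum_mono mult_left_mono) (auto simp: typical_def)
  also have "\<dots> = (\<Sum>C | C \<in> cliques n G \<and> card C \<le> q \<and> card (C \<inter> P) = 0. w (card C))"
    by (rule sum_over_levels[symmetric])
  \<comment> \<open>As \<open>0 < s\<close>, cliques disjoint from \<open>P\<close> are small
    cliques.\<close>
  also have "\<dots> \<le> A"
    unfolding A_def using w0 nn finite_cliques[of n G]
    by (intro sum_mono2) (auto simp: small_cliques_def)
  finally have low: "(\<Sum>l\<le>q. w l * (?\<mu> l / 2)) \<le> A" .
  have "w q * (?\<mu> q / 2) \<le> (\<Sum>l\<le>q. w l * (?\<mu> l / 2))"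
    using w0 \<mu>0 by (intro member_le_sum) auto
  then have top: "w q * ?\<mu> q \<le> 2 * A"
    using low by simp
  have split: "(\<Sum>C\<in>barrier n G P q r s. w (card C))
      \<le> (\<Sum>C\<in>gateways n G P q r s. w (card C))
        + (\<Sum>C | C \<in> cliques n G \<and> card C \<le> q + r \<and> card (C \<inter> P) = s. w (card C))"
    unfolding barrier_def
    using finite_cliques[of n G] w0
    by (subst sum_Un) (auto simp: gateways_def intro!: sum_nonneg)
  have "(\<Sum>C\<in>gateways n G P q r s. w (card C)) = w q * real (card (gateways n G P q r s))"
    by (simp add: gateways_def)
  also have "\<dots> \<le> w q * (g * ?\<mu> q)"
    using ty w0 by (intro mult_left_mono) (auto simp: typical_def)
  also have "\<dots> \<le> g * (2 * A)"
    using top nn by (metis mult.left_commute mult_left_mono)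
  finally have gate: "(\<Sum>C\<in>gateways n G P q r s. w (card C)) \<le> g * (2 * A)" .
  have "(\<Sum>C | C \<in> cliques n G \<and> card C \<le> q + r \<and> card (C \<inter> P) = s. w (card C))
      = (\<Sum>l\<le>q + r. w l * real (card (overlap_cliques n G P l s)))"
    by (rule sum_over_levels)
  also have "\<dots> \<le> (\<Sum>l\<le>q + r. w l * (y * ?\<mu> l))"
    using ty w0 by (intro sum_mono mult_left_mono) (auto simp: typical_def)
  also have "\<dots> = (\<Sum>l\<le>q. w l * (y * ?\<mu> l)) + (\<Sum>l\<in>{q<..q + r}. w l * (y * ?\<mu> l))"
  proof -
    have "{..q + r} = {..q} \<union> {q<..q + r}"
      by auto
    then show ?thesis
      by (simp add: sum.union_disjoint disjoint_iff)
  qed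
  finally have levels: "(\<Sum>C | C \<in> cliques n G \<and> card C \<le> q + r \<and> card (C \<inter> P) = s. w (card C))
      \<le> (\<Sum>l\<le>q. w l * (y * ?\<mu> l)) + (\<Sum>l\<in>{q<..q + r}. w l * (y * ?\<mu> l))" .
  have "(\<Sum>l\<le>q. w l * (y * ?\<mu> l)) = 2 * y * (\<Sum>l\<le>q. w l * (?\<mu> l / 2))"
    by (simp add: sum_distrib_left mult_ac)
  also have "\<dots> \<le> 2 * y * A"
    using low nn by (intro mult_left_mono) auto
  finally have lower: "(\<Sum>l\<le>q. w l * (y * ?\<mu> l)) \<le> 2 * y * A" .
  have "(\<Sum>l\<in>{q<..q + r}. w l * (y * ?\<mu> l)) \<le> (\<Sum>l\<in>{q<..q + r}. y * W * (2 * A))"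
  proof (intro sum_mono)
    fix l assume l: "l \<in> {q<..q + r}"
    have "0 \<le> W"
      using w(2)[of l] l w(1)[of l] w(1)[of q] by (smt (verit) greaterThanAtMost_iff mult_nonneg_nonneg mult_neg_pos)
    have "w l * (y * ?\<mu> l) \<le> (W * w q) * (y * ?\<mu> q)"
      using l w0 \<mu>0 nn w(2)[of l] \<open>0 \<le> W\<close> mean_cliques_decreasing[OF N(1), of l]
      by (intro mult_mono) auto
    also have "\<dots> = y * W * (w q * ?\<mu> q)"
      by (simp add: mult_ac)
    also have "\<dots> \<le> y * W * (2 * A)"
      using top nn \<open>0 \<le> W\<close> by (intro mult_left_mono) auto
    finally show "w l * (y * ?\<mu> l) \<le> y * W * (2 * A)" .
  qed
  also have "\<dots> = 2 * real r * y * W * A"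
    by simp
  finally have upper: "(\<Sum>l\<in>{q<..q + r}. w l * (y * ?\<mu> l)) \<le> 2 * real r * y * W * A" .
  have "(\<Sum>C\<in>barrier n G P q r s. w (card C)) \<le> g * (2 * A) + (2 * y * A + 2 * real r * y * W * A)"
    using split gate levels lower upper by linarith
  then show ?thesis
    unfolding A_def[symmetric] by (simp add: algebra_simps)
qed

section \<open>Choice of scales\<close>

text \<open>Since \<open>ln 2\<close> is at least 2/3, \<open>ln x\<close> is at least
  \<open>log 2 x / 2\<close>; this converts powers of \<open>n\<close> into exponentials of squared
  logarithms.\<close>

lemma powr_neg_le_exp:
  fixes x u :: real
  assumes "1 \<le> x" "0 \<le> u"
  shows "x powr - u \<le> exp (- (u * log 2 x / 2))"
proof -
  have "log 2 x / 2 \<le> ln x"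
    using assms ln2_ge_two_thirds mult_right_mono[of "1/2" "ln 2" "log 2 x"] by (simp add: log_def)
  then have "u * (log 2 x / 2) \<le> u * ln x"
    using assms by (intro mult_left_mono) auto
  then show ?thesis
    using assms by (simp add: powr_def)
qed

text \<open>\<open>L1\<close> absorbs rounding errors, \<open>x1\<close> and \<open>x2\<close> leave
  at least \<open>n / 2\<close> vertices after removing \<open>k + q + r\<close>, \<open>x3\<close>
  absorbs a logarithm in the planted overlap bound, and \<open>x4\<close> keeps the second moment
  parameter at most 1.\<close>

locale scales =
  fixes \<alpha> \<gamma> \<delta> :: real and n :: nat
  assumes \<gamma>: "0 < \<gamma>" "\<gamma> \<le> 1 - \<alpha>" and \<alpha>: "0 \<le> \<alpha>" and \<delta>: "0 < \<delta>" "\<delta> \<le> 1/8"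
    and L1: "1 \<le> \<delta> * log 2 n"
    and x1: "real n powr \<alpha> \<le> real n / 4"
    and x2: "6 * log 2 n \<le> real n"
    and x3: "4 * log 2 n \<le> real n powr (\<gamma> / 4)"
    and x4: "9/2 * (log 2 n)\<^sup>2 * real n powr (- 1/4) \<le> 1"
begin

abbreviation "L \<equiv> log 2 (real n)"

text \<open>Rounding \<open>q\<close> up and \<open>r\<close> down gives \<open>q - r\<close> at
  least \<open>(1 + \<delta>) * L\<close>, while \<open>q + r\<close> stays at most
  \<open>(1 + 4 * \<delta>) * L\<close>. Rounding \<open>s\<close> up makes an integer at least
  \<open>\<gamma> * L\<close> exactly when it is at least \<open>s\<close>.\<close>

definition "q = nat \<lceil>(1 + 2 * \<delta>) * L\<rceil>"
definition "r = nat \<lfloor>\<delta> * L\<rfloor>"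
definition "s = nat \<lceil>\<gamma> * L\<rceil>"
definition "k = nat \<lfloor>real n powr \<alpha>\<rfloor>"

lemma L8: "8 \<le> L"
proof -
  have "0 < L"
    using L1 \<delta> by (smt (verit) mult_nonneg_nonpos)
  then have "\<delta> * L \<le> 1/8 * L"
    using \<delta> by (intro mult_right_mono) auto
  then show ?thesis
    using L1 by simp
qed

lemma n_pos: "1 \<le> real n"
  using L8 by (cases n) (auto simp: log_def)

lemma n_eq: "real n = 2 powr L"
  using n_pos by simp

lemma n_powr: "real n powr t = 2 powr (L * t)"
  by (subst n_eq) (simp only: powr_powr)

lemma q_bounds: "(1 + 2 * \<delta>) * L \<le> real q" "real q \<le> (1 + 3 * \<delta>) * L"
proof -
  have "0 \<le> (1 + 2 * \<delta>) * L"
    using \<delta> L8 by simp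
  then show "(1 + 2 * \<delta>) * L \<le> real q" "real q \<le> (1 + 3 * \<delta>) * L"
    using L1 unfolding q_def by (auto simp: algebra_simps) linarith+
qed

lemma r_bounds: "\<delta> * L - 1 \<le> real r" "real r \<le> \<delta> * L" "1 \<le> r"
  using L1 unfolding r_def by linarith+

lemma s_bounds: "\<gamma> * L \<le> real s" "real s - 1 \<le> \<gamma> * L" "0 < s"
proof -
  have "0 < \<gamma> * L"
    using \<gamma> L8 by simp
  then show "\<gamma> * L \<le> real s" "real s - 1 \<le> \<gamma> * L" "0 < s"
    unfolding s_def by linarith+
qed

lemma q_plus_r: "real (q + r) \<le> (1 + 4 * \<delta>) * L"
  using q_bounds r_bounds by (simp add: algebra_simps)

lemma q_plus_r_le: "real (q + r) \<le> 3/2 * L"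
proof -
  have "(1 + 4 * \<delta>) * L \<le> 3/2 * L"
    using \<delta> L8 by (intro mult_right_mono) auto
  then show ?thesis
    using q_plus_r by linarith
qed

lemma r_le_q: "r \<le> q"
proof -
  have "\<delta> * L \<le> (1 + 2 * \<delta>) * L"
    using \<delta> L8 by (intro mult_right_mono) auto
  then have "real r \<le> real q"
    using q_bounds r_bounds by linarith
  then show ?thesis
    by simp
qed

lemma q_minus_r: "(1 + \<delta>) * L \<le> real (q - r)"
  using q_bounds(1) r_bounds(2) by (simp add: of_nat_diff[OF r_le_q] algebra_simps)

lemma \<gamma>_L_le: "\<gamma> * L \<le> L"
  using \<gamma> \<alpha> L8 by (simp add: mult_le_cancel_right1)

lemma s_le: "s \<le> q - r + 1"
proof -
  have "real s \<le> L + 1"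
    using s_bounds \<gamma>_L_le by linarith
  also have "\<dots> \<le> real (q - r) + 1"
    using q_minus_r \<delta> L8 by (simp add: algebra_simps) (smt (verit) mult_nonneg_nonneg)
  finally show ?thesis
    by linarith
qed

lemma k_le: "real k \<le> real n powr \<alpha>"
  unfolding k_def by (intro of_nat_floor) auto

lemma k_le_n: "k \<le> n"
  using k_le x1 by linarith

lemma room: "q + r \<le> n - k" "real n / 2 \<le> real (n - k - (q + r) + 1)"
proof -
  have "real (q + r) \<le> real n / 4"
    using q_plus_r_le x2 by linarith
  moreover have "real k \<le> real n / 4"
    using k_le x1 by linarith
  ultimately show "q + r \<le> n - k" "real n / 2 \<le> real (n - k - (q + r) + 1)"
    by linarith+
qed

lemma half_power_q_minus_r: "(1/2) ^ (q - r) \<le> real n powr (- (1 + \<delta>))"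
proof -
  have "(1/2) ^ (q - r) = 2 powr - real (q - r)"
    by (simp add: powr_minus powr_realpow power_one_over inverse_eq_divide)
  also have "\<dots> \<le> 2 powr (L * - (1 + \<delta>))"
    using q_minus_r by (intro powr_mono) (auto simp: algebra_simps)
  finally show ?thesis
    by (simp only: n_powr)
qed

text \<open>A new vertex needs about \<open>(1 + \<delta>) * L\<close> edges, against
  \<open>n\<close> choices if unplanted. If planted it has about \<open>n powr \<alpha>\<close>
  choices and saves a factor \<open>n powr \<gamma>\<close>, and
  \<open>\<alpha> + \<gamma> \<le> 1\<close> makes this no better.\<close>

lemma theta_bounds:
  "real n * (1/2) ^ (q - r) \<le> real n powr - \<delta>"
  "real k * 2 ^ (s - 1) * (1/2) ^ (q - r) \<le> real n powr - \<delta>"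
proof -
  have "real n * (1/2) ^ (q - r) \<le> real n powr 1 * real n powr (- (1 + \<delta>))"
    using half_power_q_minus_r n_pos by (intro mult_mono) auto
  also have "\<dots> = real n powr - \<delta>"
    by (simp only: powr_add[symmetric]) simp
  finally show "real n * (1/2) ^ (q - r) \<le> real n powr - \<delta>" .
  have "(2::real) ^ (s - 1) = 2 powr (real s - 1)"
    using s_bounds(3) by (simp add: powr_realpow[symmetric] of_nat_diff)
  also have "\<dots> \<le> 2 powr (L * \<gamma>)"
    using s_bounds(2) by (intro powr_mono) (auto simp: mult.commute)
  finally have "(2::real) ^ (s - 1) \<le> real n powr \<gamma>"
    by (simp only: n_powr)
  then have "real k * 2 ^ (s - 1) * (1/2) ^ (q - r) \<le> real n powr \<alpha> * real n powr \<gamma> * real n powr (- (1 + \<delta>))"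
    using half_power_q_minus_r k_le by (intro mult_mono) auto
  also have "\<dots> = real n powr (\<alpha> + \<gamma> - (1 + \<delta>))"
    by (simp only: powr_add[symmetric] diff_conv_add_uminus)
  also have "\<dots> \<le> real n powr - \<delta>"
    using \<gamma> n_pos by (intro powr_mono) auto
  finally show "real k * 2 ^ (s - 1) * (1/2) ^ (q - r) \<le> real n powr - \<delta>" .
qed

text \<open>As \<open>q\<close> is at most \<open>3/2 * L\<close>, the exponential factor is at most
  \<open>n powr (3/4)\<close>, which leaves a margin of \<open>n powr (- 1/4)\<close> against
  \<open>n\<close>.\<close>

lemma self_overlap_bound:
  "real q * real q * 2 powr ((real q - 1) / 2) \<le> (9/2 * L\<^sup>2 * real n powr (- 1/4)) * (real n / 2)"
proof -
  have q: "real q \<le> 3/2 * L"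
    using q_plus_r_le by simp
  have "real q * real q * 2 powr ((real q - 1) / 2) \<le> (3/2 * L) * (3/2 * L) * 2 powr (L * (3/4))"
    using q L8 by (intro mult_mono powr_mono) auto
  also have "2 powr (L * (3/4)) = real n powr (3/4)"
    by (simp only: n_powr)
  also have "real n powr (3/4) = real n powr (- 1/4) * real n powr 1"
    by (simp only: powr_add[symmetric]) simp
  finally show ?thesis
    by (simp add: power2_eq_square mult_ac)
qed

text \<open>The factors are at most \<open>n powr (1 - \<gamma>)\<close>, \<open>2 * L\<close> and
  \<open>n powr (\<gamma> / 2)\<close>; of the remaining margin
  \<open>n powr (- \<gamma> / 2)\<close>, half of the exponent is spent on the logarithm.\<close>

lemma planted_overlap_bound:
  "real k * real (q + r) * 2 powr ((real s - 1) / 2) \<le> real n powr (- \<gamma> / 4) * (real n / 2)"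
proof -
  have "real k * real (q + r) * 2 powr ((real s - 1) / 2) \<le> real n powr (1 - \<gamma>) * (2 * L) * 2 powr (L * (\<gamma> / 2))"
  proof (intro mult_mono powr_mono)
    show "real k \<le> real n powr (1 - \<gamma>)"
      using \<gamma> n_pos by (intro order.trans[OF k_le] powr_mono) auto
    show "real (q + r) \<le> 2 * L"
      using q_plus_r_le L8 by linarith
    show "(real s - 1) / 2 \<le> L * (\<gamma> / 2)"
      using s_bounds by (simp add: mult.commute)
  qed (use L8 in auto)
  also have "2 powr (L * (\<gamma> / 2)) = real n powr (\<gamma> / 2)"
    by (simp only: n_powr)
  also have "real n powr (1 - \<gamma>) * (2 * L) * real n powr (\<gamma> / 2)
      \<le> real n powr (1 - \<gamma>) * (real n powr (\<gamma> / 4) / 2) * real n powr (\<gamma> / 2)"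
    using x3 by (intro mult_right_mono mult_left_mono) auto
  also have "\<dots> = (real n powr (1 - \<gamma>) * real n powr (\<gamma> / 4) * real n powr (\<gamma> / 2)) / 2"
    by simp
  also have "real n powr (1 - \<gamma>) * real n powr (\<gamma> / 4) * real n powr (\<gamma> / 2) = real n powr (- \<gamma> / 4) * real n powr 1"
    by (simp only: powr_add[symmetric]) (simp add: field_simps)
  finally show ?thesis
    using n_pos by simp
qed

text \<open>The first moment estimates decay like \<open>y\<^sup>2\<close> and, up to polynomial
  factors in \<open>n\<close>, like \<open>g\<^sup>2\<close>. Thresholds at the square root leave an
  equally small failure probability in Markov's inequality.\<close>

definition "y = exp (- (\<gamma>\<^sup>2 / 16 * L\<^sup>2))"
definition "g = exp (- (\<delta>\<^sup>2 / 4 * L\<^sup>2))"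

lemma overlap_tail: "(real n powr (- \<gamma> / 4)) ^ s / y \<le> exp (- (\<gamma>\<^sup>2 / 16 * L\<^sup>2))"
proof -
  have "(real n powr (- \<gamma> / 4)) ^ s = real n powr (- \<gamma> / 4 * real s)"
    using n_pos by (simp add: powr_powr flip: powr_realpow)
  also have "\<dots> \<le> real n powr - (\<gamma> / 4 * (\<gamma> * L))"
    using n_pos s_bounds \<gamma> by (intro powr_mono) auto
  also have "\<dots> \<le> exp (- (\<gamma> / 4 * (\<gamma> * L) * L / 2))"
    using n_pos \<gamma> L8 by (intro powr_neg_le_exp) auto
  also have "\<dots> = exp (- (\<gamma>\<^sup>2 / 16 * L\<^sup>2)) * y"
    unfolding y_def by (simp add: power2_eq_square flip: exp_add)
  finally show ?thesis
    by (simp add: y_def pos_divide_le_eq)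
qed

lemma gateway_tail:
  "real s * 2 ^ q * (real r + 1) * (real n powr - \<delta>) ^ r / g
    \<le> (L + 1) * real n powr (3/2) * (L + 1) * (real n * exp (- (\<delta>\<^sup>2 / 4 * L\<^sup>2)))"
proof -
  have "(real n powr - \<delta>) ^ r = real n powr (- \<delta> * real r)"
    using n_pos by (simp add: powr_powr flip: powr_realpow)
  \<comment> \<open>The extra factor \<open>n\<close> pays for the rounding in \<open>r\<close>, as
    \<open>\<delta>\<close> is at most 1.\<close>
  also have "\<dots> \<le> real n powr (1 + - (\<delta> * (\<delta> * L)))"
  proof (rule powr_mono)
    have "\<delta> * (\<delta> * L - 1) \<le> \<delta> * real r"
      using r_bounds \<delta> by (intro mult_left_mono) auto
    then show "- \<delta> * real r \<le> 1 + - (\<delta> * (\<delta> * L))"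
      using \<delta> by (simp add: algebra_simps)
  qed (use n_pos in simp)
  also have "\<dots> = real n * real n powr - (\<delta> * (\<delta> * L))"
    using n_pos by (simp only: powr_add) simp
  also have "\<dots> \<le> real n * exp (- (\<delta> * (\<delta> * L) * L / 2))"
    using n_pos \<delta> L8 by (intro mult_left_mono powr_neg_le_exp) auto
  also have "\<dots> = real n * exp (- (\<delta>\<^sup>2 / 4 * L\<^sup>2)) * g"
    unfolding g_def by (simp add: power2_eq_square flip: exp_add)
  finally have "(real n powr - \<delta>) ^ r / g \<le> real n * exp (- (\<delta>\<^sup>2 / 4 * L\<^sup>2))"
    by (simp add: g_def pos_divide_le_eq)
  moreover have "real s \<le> L + 1"
    using s_bounds \<gamma>_L_le by linarith
  moreover have "(2::real) ^ q \<le> real n powr (3/2)"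
  proof -
    have "(2::real) ^ q = 2 powr real q"
      by (simp add: powr_realpow)
    also have "\<dots> \<le> 2 powr (L * (3/2))"
      using q_plus_r_le by (intro powr_mono) auto
    finally show ?thesis
      by (simp only: n_powr)
  qed
  moreover have "real r + 1 \<le> L + 1"
    using r_bounds \<delta> L8 q_plus_r_le r_le_q by linarith
  ultimately have "real s * 2 ^ q * (real r + 1) * ((real n powr - \<delta>) ^ r / g)
      \<le> (L + 1) * real n powr (3/2) * (L + 1) * (real n * exp (- (\<delta>\<^sup>2 / 4 * L\<^sup>2)))"
    using L8 by (intro mult_mono) (auto simp: g_def)
  then show ?thesis
    by simp
qed

text \<open>The three terms of \<open>prob_typical\<close> with \<open>q\<close>,
  \<open>q + 1\<close> and \<open>q + r + 1\<close> replaced by \<open>2 * L\<close>. The first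
  decays like a power of \<open>n\<close> up to logarithms, and the Gaussian factors in
  \<open>L\<close> beat the polynomial factors in the others.\<close>

definition "failure = 2 * L * (4 * (2 * L * (9/2 * L\<^sup>2 * real n powr (- 1/4))))
  + 2 * L * exp (- (\<gamma>\<^sup>2 / 16 * L\<^sup>2))
  + (L + 1) * real n powr (3/2) * (L + 1) * (real n * exp (- (\<delta>\<^sup>2 / 4 * L\<^sup>2)))"

lemma prob_typical_scales:
  assumes P: "P \<subseteq> {..<n}" "card P = k"
  shows "1 - failure \<le> measure_pmf.prob (gnp_half n) {E. typical n P q r s y g (planted n P E)}"
proof -
  let ?b = "9/2 * L\<^sup>2 * real n powr (- 1/4)" and ?c = "real n powr (- \<gamma> / 4)"
  have "1 - (real (q + 1) * (4 * (real q * ?b)) + real (q + r + 1) * (?c ^ s / y)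
      + real s * 2 ^ q * (real r + 1) * (real n powr - \<delta>) ^ r / g)
    \<le> measure_pmf.prob (gnp_half n) {E. typical n P q r s y g (planted n P E)}"
  proof (rule prob_typical[OF P(1) refl])
    show "?c \<le> 1"
      using n_pos \<gamma> powr_mono[of "- \<gamma> / 4" 0 "real n"] by simp
    show "real n / 2 \<le> real (n - card P - (q + r) + 1)" "q + r \<le> n - card P"
      using room P by auto
    show "real q * real q * 2 powr ((real q - 1) / 2) \<le> ?b * (real n / 2)"
      by (rule self_overlap_bound)
    show "real (card P) * real (q + r) * 2 powr ((real s - 1) / 2) \<le> ?c * (real n / 2)"
      using planted_overlap_bound P by simp
    show "real n * (1/2) ^ (q - r) \<le> real n powr - \<delta>"
      "real (card P) * 2 ^ (s - 1) * (1/2) ^ (q - r) \<le> real n powr - \<delta>"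
      using theta_bounds P by auto
  qed (use n_pos x4 s_bounds(3) s_le in \<open>auto simp: y_def g_def\<close>)
  moreover have "real (q + 1) * (4 * (real q * ?b)) \<le> 2 * L * (4 * (2 * L * ?b))"
    using q_plus_r_le L8 by (intro mult_mono) auto
  moreover have "real (q + r + 1) * (?c ^ s / y) \<le> 2 * L * exp (- (\<gamma>\<^sup>2 / 16 * L\<^sup>2))"
    using q_plus_r_le L8 overlap_tail by (intro mult_mono) (auto simp: y_def)
  moreover note gateway_tail
  ultimately show ?thesis
    unfolding failure_def by linarith
qed

text \<open>The Lipschitz condition bounds the weight change above level \<open>q\<close> by
  \<open>W\<close>, so the bottleneck ratio is at most
  \<open>(4 + 2 * L) * exp (- (\<delta>\<^sup>2 / 32 * L\<^sup>2))\<close>. The constant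
  \<open>c\<close> is small enough for this to beat the number of steps.\<close>

lemma slow_if_typical:
  assumes ty: "typical n P q r s y g G" and P: "card P = k"
    and small: "4 * \<delta> \<le> \<epsilon>" "\<delta> \<le> \<gamma>" "K * \<delta> \<le> \<gamma>\<^sup>2 / 32"
    and x5: "3 * (4 + 2 * L) \<le> exp (\<delta>\<^sup>2 / 64 * L\<^sup>2)" and c: "c = \<delta>\<^sup>2 / 128"
    and h: "\<forall>l l' :: nat. l \<le> n \<and> l' \<le> n \<and> real l \<le> 2.1 * L \<and> real l' \<le> 2.1 * L \<longrightarrow>
             \<bar>h l - h l'\<bar> \<le> \<bar>real l - real l'\<bar>"
    and m: "1 \<le> m" and \<beta>: "\<forall>i\<in>{1..m}. \<bar>\<beta> i\<bar> \<le> K * L" and Z: "\<forall>i\<in>{1..m}. 0 < Z i"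
    and a: "0 < a" "a < 1"
  shows "\<exists>x\<in>st_states n G m. 1 - exp (- c * L\<^sup>2) \<le>
    prob_requires_steps (st_kernel n G m h \<beta> Z a) x
      {(C, i). (1 + \<epsilon>) * L \<le> real (card C) \<or> \<gamma> * L \<le> real (card (C \<inter> P))} (exp (c * L\<^sup>2))"
proof -
  define W where "W = exp (K * \<delta> * L\<^sup>2)"
  define \<kappa> where "\<kappa> = 2 * g + 2 * y + 2 * real r * y * W"
  let ?R = "exp (c * L\<^sup>2)" and ?e = "exp (- (\<delta>\<^sup>2 / 32 * L\<^sup>2))"
  have "1 * L \<le> (1 + 2 * \<delta>) * L"
    using \<delta> L8 by (intro mult_right_mono) auto
  then have "2 powr L \<le> 2 powr real q"
    using q_bounds(1) by (intro powr_mono) auto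
  then have "real n \<le> 2 powr real q"
    using n_eq by linarith
  then have "real n \<le> 2 ^ q"
    by (simp add: powr_realpow)
  then have Nq: "n - card P \<le> 2 ^ q"
    by (metis diff_le_self le_trans of_nat_le_iff of_nat_numeral of_nat_power)
  have bottleneck: "(\<Sum>C\<in>barrier n G P q r s. exp (\<beta> i * h (card C)))
      \<le> \<kappa> * (\<Sum>C\<in>small_cliques n G P q s. exp (\<beta> i * h (card C)))" if i: "i \<in> {1..m}" for i
    unfolding \<kappa>_def
  proof (rule typical_bottleneck[OF ty Nq])
    show "q + r \<le> n - card P"
      using room P by simp
    fix l assume l: "q < l" "l \<le> q + r"
    have "l \<le> n" "q \<le> n" "real l \<le> 2.1 * L" "real q \<le> 2.1 * L"
      using l room(1) q_plus_r_le L8 by auto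
    then have "\<bar>h l - h q\<bar> \<le> real r"
      using h[rule_format, of l q] l by auto
    \<comment> \<open>Sizes up to \<open>q + r\<close> lie within the range \<open>2.1 * L\<close>
      of the Lipschitz condition, and at most \<open>r\<close> levels are crossed.\<close>
    then have "\<bar>\<beta> i\<bar> * \<bar>h l - h q\<bar> \<le> (K * L) * (\<delta> * L)"
      using \<beta> i r_bounds by (intro mult_mono) (auto intro: order.trans[OF abs_ge_zero])
    moreover have "\<beta> i * (h l - h q) \<le> \<bar>\<beta> i\<bar> * \<bar>h l - h q\<bar>"
      by (metis abs_ge_self abs_mult)
    ultimately have "\<beta> i * h l \<le> K * \<delta> * L\<^sup>2 + \<beta> i * h q"
      by (simp add: algebra_simps power2_eq_square)
    then show "exp (\<beta> i * h l) \<le> W * exp (\<beta> i * h q)"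
      by (simp add: W_def flip: exp_add)
  qed (use s_bounds(3) in \<open>auto simp: y_def g_def\<close>)
  have "\<exists>x\<in>st_states n G m. 1 - real (nat \<lceil>?R\<rceil> + 1) * \<kappa> \<le>
    prob_requires_steps (st_kernel n G m h \<beta> Z a) x
      {(C, i). (1 + \<epsilon>) * L \<le> real (card C) \<or> \<gamma> * L \<le> real (card (C \<inter> P))} ?R"
  proof (rule st_slow[OF a Z m _ s_bounds(3) bottleneck])
    fix C :: "nat set" and i :: nat
    assume "(C, i) \<in> {(C, i). (1 + \<epsilon>) * L \<le> real (card C) \<or> \<gamma> * L \<le> real (card (C \<inter> P))}"
    moreover have "(1 + 4 * \<delta>) * L \<le> (1 + \<epsilon>) * L"
      using small L8 by (intro mult_right_mono) auto
    moreover have "s \<le> card (C \<inter> P)" if "\<gamma> * L \<le> real (card (C \<inter> P))"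
      using that unfolding s_def by linarith
    ultimately show "q + r \<le> card C \<or> s \<le> card (C \<inter> P)"
      using q_plus_r by auto
  qed (use r_bounds in auto)
  \<comment> \<open>In units of \<open>\<delta>\<^sup>2 * L\<^sup>2 / 128\<close> the exponents are
    1 for the steps, 2 for the polynomial factor by \<open>x5\<close> and -4 for \<open>?e\<close>,
    which sum to -1.\<close>
  moreover have "real (nat \<lceil>?R\<rceil> + 1) * \<kappa> \<le> exp (- c * L\<^sup>2)"
  proof -
    have sq: "\<delta>\<^sup>2 * L\<^sup>2 \<le> \<gamma>\<^sup>2 * L\<^sup>2"
      using small \<delta> by (intro mult_right_mono power_mono) auto
    have nn: "0 \<le> \<gamma>\<^sup>2 * L\<^sup>2"
      by simp
    have "g \<le> ?e"
      by (simp add: g_def)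
    moreover have "y \<le> ?e"
      unfolding y_def exp_le_cancel_iff using sq nn by linarith
    \<comment> \<open>\<open>W\<close> consumes at most half of the exponent of \<open>y\<close>;
      the other half still dominates that of \<open>?e\<close> because
      \<open>\<delta> \<le> \<gamma>\<close>.\<close>
    moreover have "y * W \<le> ?e"
    proof -
      have "K * \<delta> * L\<^sup>2 \<le> \<gamma>\<^sup>2 / 32 * L\<^sup>2"
        using small by (intro mult_right_mono) auto
      then show ?thesis
        unfolding y_def W_def exp_add[symmetric] exp_le_cancel_iff using sq by linarith
    qed
    then have "2 * real r * (y * W) \<le> 2 * L * ?e"
      using r_bounds r_le_q q_plus_r_le L8 by (intro mult_mono) (auto simp: y_def W_def)
    ultimately have "\<kappa> \<le> (4 + 2 * L) * ?e"
      unfolding \<kappa>_def by (simp add: algebra_simps)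
    moreover have "1 \<le> ?R"
      by (simp add: c)
    then have "real (nat \<lceil>?R\<rceil> + 1) \<le> 3 * ?R"
      by linarith
    moreover have "0 \<le> \<kappa>"
      by (simp add: \<kappa>_def y_def g_def W_def)
    ultimately have "real (nat \<lceil>?R\<rceil> + 1) * \<kappa> \<le> 3 * ?R * ((4 + 2 * L) * ?e)"
      by (intro mult_mono) auto
    also have "\<dots> = 3 * (4 + 2 * L) * (?R * ?e)"
      by simp
    also have "\<dots> \<le> exp (\<delta>\<^sup>2 / 64 * L\<^sup>2) * (?R * ?e)"
      using x5 by (intro mult_right_mono) auto
    also have "\<dots> = exp (- c * L\<^sup>2)"
      by (simp add: c flip: exp_add)
    finally show ?thesis .
  qed
  ultimately show ?thesis
    by (meson diff_left_mono order.trans)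
qed

end

section \<open>Choice of constants and passage to the limit\<close>

theorem theorem8p4:
  fixes \<alpha> \<epsilon> \<gamma> K :: real
  assumes "0 \<le> \<alpha>" "\<alpha> < 1"
    and "0 < \<epsilon>" "\<epsilon> < 1 - \<alpha>"
    and "0 < \<gamma>" "\<gamma> \<le> 1 - \<alpha>"
    and "0 < K"
  shows "\<exists>c>0.
    (\<lambda>n. measure_pmf.prob (planted_clique_pmf n (nat \<lfloor>real n powr \<alpha>\<rfloor>))
      {(E, PC).
        \<forall>(h :: nat \<Rightarrow> real) (m :: nat) (\<beta> :: nat \<Rightarrow> real) (Z :: nat \<Rightarrow> real) (a :: real).
          h 0 = 0 \<and>
          (\<forall>q q' :: nat. q \<le> n \<and> q' \<le> n \<and> real q \<le> 2.1 * log 2 n \<and> real q' \<le> 2.1 * log 2 n \<longrightarrow>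
             \<bar>h q - h q'\<bar> \<le> \<bar>real q - real q'\<bar>) \<and>
          1 \<le> m \<and>
          strict_mono_on {1..m} \<beta> \<and>
          (\<forall>i\<in>{1..m}. \<bar>\<beta> i\<bar> \<le> K * log 2 n) \<and>
          (\<forall>i\<in>{1..m}. 0 < Z i) \<and>
          0 < a \<and> a < 1 \<longrightarrow>
          (\<exists>x\<^sub>0 \<in> st_states n E m.
             prob_requires_steps (st_kernel n E m h \<beta> Z a) x\<^sub>0
               {(C, i). (1 + \<epsilon>) * log 2 n \<le> real (card C) \<or>
                        \<gamma> * log 2 n \<le> real (card (C \<inter> PC))}
               (exp (c * (log 2 n)\<^sup>2))
             \<ge> 1 - exp (- c * (log 2 n)\<^sup>2))})
    \<longlonglongrightarrow> 1"
proof -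
  \<comment> \<open>The bound 1/8 keeps \<open>q + r\<close> below \<open>3/2 * L\<close>,
    \<open>\<epsilon>/4\<close> keeps it below the target size, \<open>\<gamma>\<close> makes the
    exponents in \<open>\<delta>\<close> the weakest ones, and the last bound keeps the temperature
    cost \<open>W\<close> below the gain in \<open>y\<close>.\<close>
  define \<delta> where "\<delta> = Min {1/8, \<epsilon>/4, \<gamma>, \<gamma>\<^sup>2 / (32 * K)}"
  define c where "c = \<delta>\<^sup>2 / 128"
  have \<delta>_props: "0 < \<delta>" "\<delta> \<le> 1/8" "\<delta> \<le> \<epsilon>/4" "\<delta> \<le> \<gamma>" "\<delta> \<le> \<gamma>\<^sup>2 / (32 * K)"
    using assms by (simp_all add: \<delta>_def)
  have K_\<delta>: "K * \<delta> \<le> \<gamma>\<^sup>2 / 32"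
    using \<delta>_props(5) assms by (simp add: field_simps)
  have large: "\<forall>\<^sub>F n in sequentially. scales \<alpha> \<gamma> \<delta> n"
    unfolding scales_def
  proof (intro eventually_conj)
    show "\<forall>\<^sub>F n in sequentially. 1 \<le> \<delta> * log 2 (real n)"
      using \<delta>_props(1) by real_asymp
    show "\<forall>\<^sub>F n in sequentially. real n powr \<alpha> \<le> real n / 4"
      using assms(2) by real_asymp
    show "\<forall>\<^sub>F n in sequentially. 6 * log 2 (real n) \<le> real n"
      by real_asymp
    show "\<forall>\<^sub>F n in sequentially. 4 * log 2 (real n) \<le> real n powr (\<gamma> / 4)"
      using assms(5) by real_asymp
    show "\<forall>\<^sub>F n in sequentially. 9/2 * (log 2 (real n))\<^sup>2 * real n powr (- 1/4) \<le> 1"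
      by real_asymp
  qed (use assms \<delta>_props in auto)
  have large': "\<forall>\<^sub>F n in sequentially. 3 * (4 + 2 * log 2 (real n)) \<le> exp (\<delta>\<^sup>2 / 64 * (log 2 (real n))\<^sup>2)"
    using \<delta>_props(1) by real_asymp
  \<comment> \<open>This is \<open>failure\<close> written out as a function of \<open>n\<close>,
    since its limit is taken outside the locale, where \<open>n\<close> is fixed.\<close>
  let ?fail = "\<lambda>n. 2 * log 2 (real n) * (4 * (2 * log 2 (real n) * (9/2 * (log 2 (real n))\<^sup>2 * real n powr (- 1/4))))
    + 2 * log 2 (real n) * exp (- (\<gamma>\<^sup>2 / 16 * (log 2 (real n))\<^sup>2))
    + (log 2 (real n) + 1) * real n powr (3/2) * (log 2 (real n) + 1)
      * (real n * exp (- (\<delta>\<^sup>2 / 4 * (log 2 (real n))\<^sup>2)))"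
  have "?fail \<longlonglongrightarrow> 0"
    using \<delta>_props(1) assms(5) by real_asymp
  then have lim: "(\<lambda>n. 1 - ?fail n) \<longlonglongrightarrow> 1"
    using tendsto_diff[OF tendsto_const[of 1]] by fastforce
  show ?thesis
  proof (intro exI[of _ c] conjI)
    show "0 < c"
      using \<delta>_props by (simp add: c_def)
    let ?S = "\<lambda>n. {(E, PC).
        \<forall>(h :: nat \<Rightarrow> real) (m :: nat) (\<beta> :: nat \<Rightarrow> real) (Z :: nat \<Rightarrow> real) (a :: real).
          h 0 = 0 \<and>
          (\<forall>q q' :: nat. q \<le> n \<and> q' \<le> n \<and> real q \<le> 2.1 * log 2 n \<and> real q' \<le> 2.1 * log 2 n \<longrightarrow>
             \<bar>h q - h q'\<bar> \<le> \<bar>real q - real q'\<bar>) \<and>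
          1 \<le> m \<and>
          strict_mono_on {1..m} \<beta> \<and>
          (\<forall>i\<in>{1..m}. \<bar>\<beta> i\<bar> \<le> K * log 2 n) \<and>
          (\<forall>i\<in>{1..m}. 0 < Z i) \<and>
          0 < a \<and> a < 1 \<longrightarrow>
          (\<exists>x\<^sub>0 \<in> st_states n E m.
             prob_requires_steps (st_kernel n E m h \<beta> Z a) x\<^sub>0
               {(C, i). (1 + \<epsilon>) * log 2 n \<le> real (card C) \<or>
                        \<gamma> * log 2 n \<le> real (card (C \<inter> PC))}
               (exp (c * (log 2 n)\<^sup>2))
             \<ge> 1 - exp (- c * (log 2 n)\<^sup>2))}"
    have "\<forall>\<^sub>F n in sequentially.
        1 - ?fail n \<le> measure_pmf.prob (planted_clique_pmf n (nat \<lfloor>real n powr \<alpha>\<rfloor>)) (?S n)"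
      using large large'
    proof eventually_elim
      case (elim n)
      interpret scales \<alpha> \<gamma> \<delta> n
        by (rule elim(1))
      show ?case
        unfolding k_def[symmetric] failure_def[symmetric]
      proof (rule prob_planted_ge[OF k_le_n])
        fix P :: "nat set" assume P: "P \<subseteq> {..<n}" "card P = k"
        have "(G, P) \<in> ?S n" if "typical n P q r s y g G" for G
          unfolding mem_Collect_eq prod.case
          using slow_if_typical[OF that P(2) _ \<delta>_props(4) K_\<delta> elim(2) c_def, of \<epsilon>] \<delta>_props(3) by simp
        then have "{E. typical n P q r s y g (planted n P E)} \<subseteq> {E. (planted n P E, P) \<in> ?S n}"
          by blast
        then have "measure_pmf.prob (gnp_half n) {E. typical n P q r s y g (planted n P E)}
            \<le> measure_pmf.prob (gnp_half n) {E. (planted n P E, P) \<in> ?S n}"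
          by (intro measure_pmf.finite_measure_mono) auto
        then show "1 - failure \<le> measure_pmf.prob (gnp_half n) {E. (planted n P E, P) \<in> ?S n}"
          using prob_typical_scales[OF P] by linarith
      qed
    qed
    \<comment> \<open>The probability is squeezed between \<open>1 - ?fail n\<close> and 1.\<close>
    then show "(\<lambda>n. measure_pmf.prob (planted_clique_pmf n (nat \<lfloor>real n powr \<alpha>\<rfloor>)) (?S n)) \<longlonglongrightarrow> 1"
      by (rule tendsto_sandwich[OF _ _ lim tendsto_const]) (simp add: measure_pmf.prob_le_1)
  qed
qed

end
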